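(* The norm $\|\cdot\|_{2^*}$ lacks weak continuity at any $u\in H_{0,r}^1(\mathbb{D})$; that is, for every $u\in H_{0,r}^1(\mathbb{D})$ there is a sequence $(u_k)$ in $H_{0,r}^1(\mathbb{D})$ with $u_k\rightharpoonup u$ weakly in $H_{0,r}^1(\mathbb{D})$ such that $\|u_k\|_{2^*}$ does not converge to $\|u\|_{2^*}$.
   Context: $\mathbb{D}$ is the open unit disk in $\mathbb{R}^2$. $H_0^1(\mathbb{D})$ is the usual Sobolev space with norm $\|\nabla u\|_2$, and $H_{0,r}^1(\mathbb{D})$ is its subspace of radial functions. A radial function is written $u(r)$ with $r=|x|$; elements of $H_{0,r}^1(\mathbb{D})$ are identified with their representatives that are continuous on $\mathbb{D}\setminus\{0\}$. For $u\in H_{0,r}^1(\mathbb{D})$ define $$\|u\|_{2^*}=\sup_{r\in(0,1)}\frac{|u(r)|}{\left(\frac{1}{2\pi}\log\frac{1}{r}\right)^{1/2}}.$$ *)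

theory Defs
  imports "HOL-Analysis.Analysis"
begin

text \<open>
  Functions on the open unit disk are represented by total functions on \<open>real^2\<close>, of which
  only the values on the disk matter. Elements of Sobolev spaces are represented by functions
  rather than by classes modulo null sets.
\<close>

abbreviation disk :: "(real^2) set"
  where "disk \<equiv> ball 0 1"

definition L2_disk :: "(real^2 \<Rightarrow> 'b::euclidean_space) \<Rightarrow> bool" where
  "L2_disk f \<longleftrightarrow> f \<in> borel_measurable (lebesgue_on disk) \<and>
     integrable (lebesgue_on disk) (\<lambda>x. (norm (f x))\<^sup>2)"

definition L2_norm_disk :: "(real^2 \<Rightarrow> 'b::euclidean_space) \<Rightarrow> real" where
  "L2_norm_disk f = sqrt (LINT x|lebesgue_on disk. (norm (f x))\<^sup>2)"

definition partial_deriv :: "2 \<Rightarrow> (real^2 \<Rightarrow> real) \<Rightarrow> real^2 \<Rightarrow> real" where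
  "partial_deriv i f x = frechet_derivative f (at x) (axis i 1)"

primrec C_k :: "nat \<Rightarrow> (real^2 \<Rightarrow> real) \<Rightarrow> bool" where
  "C_k 0 f \<longleftrightarrow> continuous_on UNIV f"
| "C_k (Suc k) f \<longleftrightarrow> (\<forall>x. f differentiable (at x)) \<and> (\<forall>i. C_k k (partial_deriv i f))"

definition test_function :: "(real^2 \<Rightarrow> real) \<Rightarrow> bool" where
  "test_function \<phi> \<longleftrightarrow> (\<forall>k. C_k k \<phi>) \<and>
     compact (closure {x. \<phi> x \<noteq> 0}) \<and> closure {x. \<phi> x \<noteq> 0} \<subseteq> disk"

definition is_weak_gradient :: "(real^2 \<Rightarrow> real) \<Rightarrow> (real^2 \<Rightarrow> real^2) \<Rightarrow> bool" where
  "is_weak_gradient u G \<longleftrightarrow> L2_disk G \<and>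
     (\<forall>\<phi> i. test_function \<phi> \<longrightarrow>
        (LINT x|lebesgue_on disk. u x * partial_deriv i \<phi> x) =
        - (LINT x|lebesgue_on disk. (G x $ i) * \<phi> x))"

definition H1 :: "(real^2 \<Rightarrow> real) set" where
  "H1 = {u. L2_disk u \<and> (\<exists>G. is_weak_gradient u G)}"

text \<open>
  The weak gradient is only determined up to a null set; the choice of a representative does
  not affect the norms below.
\<close>

definition weak_gradient :: "(real^2 \<Rightarrow> real) \<Rightarrow> real^2 \<Rightarrow> real^2" where
  "weak_gradient u = (SOME G. is_weak_gradient u G)"

definition H1_norm :: "(real^2 \<Rightarrow> real) \<Rightarrow> real" where
  "H1_norm u = sqrt ((L2_norm_disk u)\<^sup>2 + (L2_norm_disk (weak_gradient u))\<^sup>2)"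

definition H10 :: "(real^2 \<Rightarrow> real) set" where
  "H10 = {u \<in> H1. \<exists>\<phi>. (\<forall>k. test_function (\<phi> k)) \<and>
            (\<lambda>k::nat. H1_norm (\<lambda>x. \<phi> k x - u x)) \<longlonglongrightarrow> 0}"

definition H10_norm :: "(real^2 \<Rightarrow> real) \<Rightarrow> real" where
  "H10_norm u = L2_norm_disk (weak_gradient u)"

text \<open>Radial elements are given by their representatives continuous off the origin.\<close>

definition H10_rad :: "(real^2 \<Rightarrow> real) set" where
  "H10_rad = {u \<in> H10. continuous_on (disk - {0}) u \<and>
     (\<forall>x \<in> disk - {0}. \<forall>y \<in> disk - {0}. norm x = norm y \<longrightarrow> u x = u y)}"

definition radial_profile :: "(real^2 \<Rightarrow> real) \<Rightarrow> real \<Rightarrow> real" where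
  "radial_profile u r = u (r *\<^sub>R axis 1 1)"

text \<open>The supremum is taken in the extended reals, so that it is meaningful without first
  establishing boundedness.\<close>

definition norm_2star :: "(real^2 \<Rightarrow> real) \<Rightarrow> ereal" where
  "norm_2star u = (SUP r\<in>{0<..<1}.
     ereal (\<bar>radial_profile u r\<bar> / sqrt (1 / (2 * pi) * ln (1 / r))))"

text \<open>Boundedness together with linearity makes such an \<open>L\<close> insensitive to modifications on
  null sets.\<close>

definition H10_rad_functional :: "((real^2 \<Rightarrow> real) \<Rightarrow> real) \<Rightarrow> bool" where
  "H10_rad_functional L \<longleftrightarrow>
     (\<forall>u\<in>H10_rad. \<forall>v\<in>H10_rad. L (\<lambda>x. u x + v x) = L u + L v) \<and>
     (\<forall>c. \<forall>u\<in>H10_rad. L (\<lambda>x. c * u x) = c * L u) \<and>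
     (\<exists>C. \<forall>u\<in>H10_rad. \<bar>L u\<bar> \<le> C * H10_norm u)"

definition H10_rad_weakly_tendsto ::
    "(nat \<Rightarrow> real^2 \<Rightarrow> real) \<Rightarrow> (real^2 \<Rightarrow> real) \<Rightarrow> bool" where
  "H10_rad_weakly_tendsto U u \<longleftrightarrow>
     (\<forall>L. H10_rad_functional L \<longrightarrow> (\<lambda>k. L (U k)) \<longlonglongrightarrow> L u)"

end

theory Submission
  imports Defs
begin

text \<open>
  Test functions \<open>e\<^sub>k\<close> of height \<open>sqrt \<delta>\<^sub>k\<close> on disjoint annuli of width about \<open>\<delta>\<^sub>k\<close> next to the
  boundary circle, with \<open>\<delta>\<^sub>k\<close> tending to 0, have bounded Dirichlet norm, and their quotient in
  \<open>norm_2star\<close> is bounded away from 0. Since the gradients have disjoint supports, Bessel's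
  inequality makes \<open>e\<^sub>k\<close> tend weakly to 0. As \<open>norm_2star u\<close> is finite, \<open>u + t e\<^sub>k\<close> with a large
  constant \<open>t\<close> is the required sequence. Finiteness follows by testing the gradient of \<open>u\<close>
  against the fields \<open>h (|x|\<^sup>2) x / |x|\<^sup>2\<close> with \<open>h\<close> a smoothed step: their divergence
  concentrates on a circle, and the square of their \<open>L\<^sup>2\<close> norm is at most \<open>2 pi log (1/r)\<close>.
\<close>

section \<open>Smooth functions built from exp (-1/s)\<close>

text \<open>Near the unit circle \<open>log (1/r)\<close> is comparable to
  \<open>1 - r\<^sup>2\<close>, so height \<open>sqrt \<delta>\<close> at distance about
  \<open>\<delta>\<close> is the scale at which the quotient and the Dirichlet energy are both of
  order one. Adding a large multiple of such a bump, instead of a perturbation adapted to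
  \<open>u\<close>, treats all \<open>u\<close> alike: only a finite bound for
  \<open>norm_2star u\<close> enters, not where the supremum is approached. The definitions shape
  the rest. \<open>weak_gradient\<close> is an arbitrary choice, so no norm can be computed before
  weak gradients are known to be unique almost everywhere; this requires the fundamental lemma of
  the calculus of variations. An element \<open>u\<close> is accessible only through its weak
  gradient and its approximating test functions, with no absolute continuity of its profile at hand;
  hence its value at \<open>r\<close> is recovered from an average over a thin annulus and the
  continuity of the representative. Functionals act on \<open>H10_rad\<close> only, so Bessel's
  inequality is obtained by evaluating them on finite combinations of bumps, without a Riesz
  representation.\<close>

definition flat :: "nat \<Rightarrow> real \<Rightarrow> real" where
  "flat n s = (if s > 0 then inverse s ^ n * exp (- inverse s) else 0)"

text \<open>From the right, with \<open>t = inverse s\<close>, this is the decay of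
  \<open>t ^ n / exp t\<close> at infinity; from the left \<open>flat n\<close> is identically
  0.\<close>

lemma flat_tendsto_0: "(flat n \<longlongrightarrow> 0) (at 0)"
proof -
  have "((\<lambda>s. inverse s ^ n / exp (inverse s)) \<longlongrightarrow> (0::real)) (at_right 0)"
    by (rule filterlim_compose[OF tendsto_power_div_exp_0])
       (simp add: filterlim_inverse_at_top_right)
  then have "(flat n \<longlongrightarrow> 0) (at_right 0)"
    by (rule Lim_transform_eventually)
       (auto simp: eventually_at_right_less flat_def exp_minus field_simps
             intro!: eventually_at_rightI[of 0 1])
  moreover have "(flat n \<longlongrightarrow> 0) (at_left 0)"
    by (rule tendsto_eventually) (auto simp: flat_def intro!: eventually_at_leftI[of "-1"])
  ultimately show ?thesis
    by (simp add: filterlim_split_at)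
qed

text \<open>The reason for the index \<open>n\<close>: the span of the family is closed under
  differentiation, so one function per power suffices for all orders.\<close>

lemma flat_derivative:
  "(flat n has_real_derivative (flat (n + 2) s - real n * flat (n + 1) s)) (at s)"
proof -
  consider "s > 0" | "s < 0" | "s = 0" by linarith
  then show ?thesis
  proof cases
    case 1
    have "((\<lambda>y. y ^ n * exp (- y)) has_real_derivative
        (real n * inverse s ^ (n - 1) * exp (- inverse s) - inverse s ^ n * exp (- inverse s)))
        (at (inverse s))"
      by (auto intro!: derivative_eq_intros)
    from DERIV_chain2[OF this DERIV_inverse] 1
    have "((\<lambda>s. inverse s ^ n * exp (- inverse s)) has_real_derivative
        (real n * inverse s ^ (n - 1) * exp (- inverse s) - inverse s ^ n * exp (- inverse s)) *
        - (inverse s ^ 2)) (at s)"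
      by (simp add: numeral_2_eq_2)
    also have "(real n * inverse s ^ (n - 1) * exp (- inverse s) - inverse s ^ n * exp (- inverse s)) *
        - (inverse s ^ 2) = flat (n + 2) s - real n * flat (n + 1) s"
      \<comment> \<open>The case split removes the truncated \<open>n - 1\<close>: for
        \<open>n = 0\<close> the factor \<open>real n\<close> vanishes.\<close>
      using 1 by (cases n) (simp_all add: flat_def power2_eq_square algebra_simps)
    finally have "((\<lambda>s. inverse s ^ n * exp (- inverse s)) has_real_derivative
        (flat (n + 2) s - real n * flat (n + 1) s)) (at s)" .
    then show ?thesis
      by (rule has_field_derivative_transform_within_open[of _ _ _ "{0<..}"])
         (use 1 in \<open>auto simp: flat_def\<close>)
  next
    case 2
    have "((\<lambda>s. 0) has_real_derivative (flat (n + 2) s - real n * flat (n + 1) s)) (at s)"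
      using 2 by (simp add: flat_def)
    then show ?thesis
      by (rule has_field_derivative_transform_within_open[of _ _ _ "{..<0}"])
         (use 2 in \<open>auto simp: flat_def\<close>)
  next
    case 3
    \<comment> \<open>At 0 the difference quotient of \<open>flat n\<close> is again a member of the
      family, whose limit at 0 is known.\<close>
    have "(\<lambda>h. (flat n (0 + h) - flat n 0) / h) = flat (n + 1)"
      by (auto simp: flat_def fun_eq_iff divide_inverse)
    then show ?thesis
      using flat_tendsto_0[of "n + 1"] 3 by (simp add: DERIV_def flat_def)
  qed
qed

text \<open>A syntactic class closed under partial derivatives. Membership therefore yields
  \<open>C_k\<close> for every \<open>k\<close> by one induction, with no computation of higher
  derivatives.\<close>

inductive smooth_expr :: "(real^2 \<Rightarrow> real) \<Rightarrow> bool" where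
  const: "smooth_expr (\<lambda>x. c)"
| coord: "smooth_expr (\<lambda>x. x $ i)"
| add: "smooth_expr f \<Longrightarrow> smooth_expr g \<Longrightarrow> smooth_expr (\<lambda>x. f x + g x)"
| mult: "smooth_expr f \<Longrightarrow> smooth_expr g \<Longrightarrow> smooth_expr (\<lambda>x. f x * g x)"
| flat: "smooth_expr f \<Longrightarrow> smooth_expr (\<lambda>x. flat n (f x))"

lemma smooth_expr_diff: "smooth_expr f \<Longrightarrow> smooth_expr g \<Longrightarrow> smooth_expr (\<lambda>x. f x - g x)"
  using smooth_expr.add[OF _ smooth_expr.mult[OF smooth_expr.const[of "-1"]]] by fastforce

lemma smooth_expr_norm_square: "smooth_expr (\<lambda>x. (norm x)\<^sup>2)"
proof -
  have "smooth_expr (\<lambda>x. x $ 1 * x $ 1 + x $ 2 * x $ 2)"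
    by (intro smooth_expr.intros)
  then show ?thesis
    by (simp add: power2_norm_eq_inner inner_vec_def sum_2)
qed

lemma partial_deriv_eqI:
  assumes "(f has_derivative f') (at x)"
  shows "partial_deriv i f x = f' (axis i 1)"
  using frechet_derivative_at[OF assms] by (simp add: partial_deriv_def)

lemma smooth_expr_partial_deriv:
  "smooth_expr f \<Longrightarrow> (\<forall>x. f differentiable (at x)) \<and> (\<forall>i. smooth_expr (partial_deriv i f))"
proof (induction rule: smooth_expr.induct)
  case (const c)
  have "partial_deriv i (\<lambda>x. c) = (\<lambda>x. 0)" for i
    by (rule ext, subst partial_deriv_eqI) (rule has_derivative_const, simp)
  then show ?case by (auto intro: smooth_expr.const)
next
  case (coord j)
  have D: "((\<lambda>x. x $ j) has_derivative (\<lambda>h. h $ j)) (at x)" for x :: "real^2"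
    by (rule bounded_linear_imp_has_derivative[OF bounded_linear_vec_nth])
  have "partial_deriv i (\<lambda>x. x $ j) = (\<lambda>x. axis i 1 $ j)" for i
    by (rule ext, subst partial_deriv_eqI[OF D]) simp
  then show ?case using D by (auto intro: smooth_expr.const differentiableI)
next
  case (add f g)
  have D: "((\<lambda>x. f x + g x) has_derivative
      (\<lambda>h. frechet_derivative f (at x) h + frechet_derivative g (at x) h)) (at x)" for x
    using add.IH by (intro has_derivative_add) (auto simp: frechet_derivative_works)
  have "partial_deriv i (\<lambda>x. f x + g x) = (\<lambda>x. partial_deriv i f x + partial_deriv i g x)" for i
    by (rule ext, subst partial_deriv_eqI[OF D]) (simp add: partial_deriv_def)
  then show ?case using D add by (auto intro: smooth_expr.add differentiableI)
next
  case (mult f g)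
  have D: "((\<lambda>x. f x * g x) has_derivative
      (\<lambda>h. f x * frechet_derivative g (at x) h + frechet_derivative f (at x) h * g x)) (at x)" for x
    using mult.IH by (intro has_derivative_mult) (auto simp: frechet_derivative_works)
  have "partial_deriv i (\<lambda>x. f x * g x) = (\<lambda>x. f x * partial_deriv i g x + partial_deriv i f x * g x)" for i
    by (rule ext, subst partial_deriv_eqI[OF D]) (simp add: partial_deriv_def)
  then show ?case using D mult
    by (auto intro!: smooth_expr.add smooth_expr.mult differentiableI)
next
  case (flat f n)
  have D: "((\<lambda>x. flat n (f x)) has_derivative (\<lambda>h. frechet_derivative f (at x) h *
      (flat (n + 2) (f x) - real n * flat (n + 1) (f x)))) (at x)" for x
  proof -
    have "(f has_derivative frechet_derivative f (at x)) (at x)"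
      using flat.IH by (auto simp: frechet_derivative_works)
    from has_derivative_compose[OF this flat_derivative[of n "f x", unfolded has_field_derivative_def]]
    show ?thesis by (simp add: mult.commute)
  qed
  have "partial_deriv i (\<lambda>x. flat n (f x)) =
      (\<lambda>x. partial_deriv i f x * (flat (n + 2) (f x) - real n * flat (n + 1) (f x)))" for i
    by (rule ext, subst partial_deriv_eqI[OF D]) (simp add: partial_deriv_def)
  then show ?case using D flat
    by (auto intro!: smooth_expr.intros smooth_expr_diff differentiableI)
qed

lemma smooth_expr_continuous: "smooth_expr f \<Longrightarrow> continuous_on UNIV f"
  using smooth_expr_partial_deriv
  by (simp add: continuous_at_imp_continuous_on differentiable_imp_continuous_within)

lemma smooth_expr_C_k: "smooth_expr f \<Longrightarrow> C_k k f"
  by (induction k arbitrary: f) (auto simp: smooth_expr_partial_deriv smooth_expr_continuous)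

section \<open>Test functions and their extension by zero\<close>

lemma test_functionI:
  assumes "smooth_expr f" "\<rho> < 1" "\<And>x. f x \<noteq> 0 \<Longrightarrow> norm x \<le> \<rho>"
  shows "test_function f"
proof -
  have "closure {x. f x \<noteq> 0} \<subseteq> cball 0 \<rho>"
    using assms(3) by (intro closure_minimal) auto
  then show ?thesis
    using assms(1,2) bounded_subset[OF bounded_cball, of "closure {x. f x \<noteq> 0}" 0 \<rho>]
    unfolding test_function_def compact_eq_bounded_closed
    by (auto simp: smooth_expr_C_k subset_iff)
qed

lemma test_function_continuous: "test_function \<phi> \<Longrightarrow> continuous_on UNIV \<phi>"
  unfolding test_function_def using C_k.simps(1) by blast

lemma test_function_differentiable:
  assumes "test_function \<phi>" shows "\<phi> differentiable (at x)"
  using assms C_k.simps(2)[of 0 \<phi>] unfolding test_function_def by blast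

lemma test_function_partial_continuous:
  assumes "test_function \<phi>" shows "continuous_on UNIV (partial_deriv i \<phi>)"
  using assms C_k.simps(2)[of 0 \<phi>] unfolding test_function_def by simp

lemma test_function_outside:
  assumes "test_function \<phi>" "norm x \<ge> 1" shows "\<phi> x = 0" "partial_deriv i \<phi> x = 0"
proof -
  let ?K = "closure {x. \<phi> x \<noteq> 0}"
  have x: "x \<notin> ?K" using assms unfolding test_function_def by auto
  then show "\<phi> x = 0" using closure_subset[of "{x. \<phi> x \<noteq> 0}"] by blast
  have "((\<lambda>x. 0) has_derivative (\<lambda>h. 0)) (at x)" by simp
  then have "(\<phi> has_derivative (\<lambda>h. 0)) (at x)"
    \<comment> \<open>The complement of the closed support is open and contains the unit circle, so
      the derivative vanishes on the circle as well.\<close>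
    by (rule has_derivative_transform_within_open[of _ _ _ _ "- ?K"])
       (use x closure_subset[of "{x. \<phi> x \<noteq> 0}"] in auto)
  then show "partial_deriv i \<phi> x = 0" by (subst partial_deriv_eqI) auto
qed

section \<open>Square integrable functions and integration by parts\<close>

abbreviation "\<mu> \<equiv> lebesgue_on disk"

lemma finite_measure_disk: "finite_measure \<mu>"
  using emeasure_bounded_finite[of disk]
  by (intro finite_measureI) (simp add: emeasure_restrict_space less_top)

lemma borel_imp_measurable_disk:
  assumes "f \<in> borel_measurable borel" shows "f \<in> borel_measurable \<mu>"
  using assms by (auto intro!: measurable_restrict_space1 measurable_completion)

lemma continuous_imp_measurable_disk:
  fixes f :: "real^2 \<Rightarrow> 'b::euclidean_space"
  shows "continuous_on UNIV f \<Longrightarrow> f \<in> borel_measurable \<mu>"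
  by (intro borel_imp_measurable_disk borel_measurable_continuous_onI)

text \<open>Moves integrals to the whole plane, where translation invariance is available.\<close>

lemma integral_disk_eq_lborel:
  fixes f :: "real^2 \<Rightarrow> real"
  assumes "f \<in> borel_measurable borel" "\<And>x. norm x \<ge> 1 \<Longrightarrow> f x = 0"
  shows "(LINT x|\<mu>. f x) = (LINT x|lborel. f x)"
proof -
  have "(\<lambda>x. indicator disk x *\<^sub>R f x) = f"
    using assms(2) by (fastforce simp: indicator_def)
  then show ?thesis
    using assms(1) by (simp add: integral_restrict_space integral_completion)
qed

lemma L2_disk_measurable [measurable_dest]: "L2_disk f \<Longrightarrow> f \<in> borel_measurable \<mu>"
  by (simp add: L2_disk_def)

lemma L2_disk_integrable: "L2_disk f \<Longrightarrow> integrable \<mu> (\<lambda>x. (norm (f x))\<^sup>2)"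
  by (simp add: L2_disk_def)

lemma L2_norm_square: "(L2_norm_disk f)\<^sup>2 = (LINT x|\<mu>. (norm (f x))\<^sup>2)"
  by (simp add: L2_norm_disk_def)

lemma L2_norm_nonneg: "0 \<le> L2_norm_disk f"
  by (simp add: L2_norm_disk_def)

lemma L2_disk_add:
  assumes f: "L2_disk f" and g: "L2_disk g" shows "L2_disk (\<lambda>x. f x + g x)"
  unfolding L2_disk_def
proof
  show "(\<lambda>x. f x + g x) \<in> borel_measurable \<mu>"
    using f g by measurable
  show "integrable \<mu> (\<lambda>x. (norm (f x + g x))\<^sup>2)"
  proof (rule Bochner_Integration.integrable_bound)
    show "integrable \<mu> (\<lambda>x. 2 * (norm (f x))\<^sup>2 + 2 * (norm (g x))\<^sup>2)"
      using f g by (auto simp: L2_disk_integrable)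
    have "(norm (f x + g x))\<^sup>2 \<le> 2 * (norm (f x))\<^sup>2 + 2 * (norm (g x))\<^sup>2" for x
      using power_mono[OF norm_triangle_ineq[of "f x" "g x"], of 2]
        sum_squares_bound[of "norm (f x)" "norm (g x)"] by (simp add: power2_sum)
    then show "AE x in \<mu>. norm ((norm (f x + g x))\<^sup>2) \<le> norm (2 * (norm (f x))\<^sup>2 + 2 * (norm (g x))\<^sup>2)"
      by (intro AE_I2) simp
  qed (use f g in measurable)
qed

lemma L2_disk_scaleR:
  assumes f: "L2_disk f" shows "L2_disk (\<lambda>x. c *\<^sub>R f x)"
  using f unfolding L2_disk_def
  by (auto simp: power_mult_distrib intro: borel_measurable_const_scaleR)

lemma L2_disk_diff: "L2_disk f \<Longrightarrow> L2_disk g \<Longrightarrow> L2_disk (\<lambda>x. f x - g x)"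
  using L2_disk_add[OF _ L2_disk_scaleR[of _ "-1"]] by fastforce

lemma L2_norm_cong_AE:
  assumes "L2_disk f" "L2_disk g" "AE x in \<mu>. f x = g x"
  shows "L2_norm_disk f = L2_norm_disk g"
proof -
  have "(LINT x|\<mu>. (norm (f x))\<^sup>2) = (LINT x|\<mu>. (norm (g x))\<^sup>2)"
    using assms by (intro integral_cong_AE) auto
  then show ?thesis
    by (simp add: L2_norm_disk_def)
qed

lemma L2_disk_continuous:
  fixes f :: "real^2 \<Rightarrow> 'b::euclidean_space"
  assumes f: "continuous_on UNIV f" shows "L2_disk f"
proof -
  have "compact (f ` cball 0 1)"
    using f by (intro compact_continuous_image) (auto intro: continuous_on_subset)
  then obtain B where B: "\<And>x. x \<in> cball 0 1 \<Longrightarrow> norm (f x) \<le> B"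
    by (meson bounded_iff compact_imp_bounded image_eqI)
  have "norm ((norm (f x))\<^sup>2) \<le> B\<^sup>2" if "x \<in> space \<mu>" for x
    using that B[of x] by (auto simp: power_mono)
  with continuous_imp_measurable_disk[OF f] show ?thesis
    unfolding L2_disk_def
    by (auto intro!: finite_measure.integrable_const_bound[OF finite_measure_disk, of _ "B\<^sup>2"])
qed

lemma L2_disk_inner_integrable:
  assumes f: "L2_disk f" and g: "L2_disk g" shows "integrable \<mu> (\<lambda>x. f x \<bullet> g x)"
proof (rule Bochner_Integration.integrable_bound)
  show "integrable \<mu> (\<lambda>x. (norm (f x))\<^sup>2 + (norm (g x))\<^sup>2)"
    using f g by (auto simp: L2_disk_integrable)
  have "\<bar>f x \<bullet> g x\<bar> \<le> (norm (f x))\<^sup>2 + (norm (g x))\<^sup>2" for x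
    using Cauchy_Schwarz_ineq2[of "f x" "g x"] sum_squares_bound[of "norm (f x)" "norm (g x)"]
      zero_le_mult_iff[of "norm (f x)" "norm (g x)"] by simp
  then show "AE x in \<mu>. norm (f x \<bullet> g x) \<le> norm ((norm (f x))\<^sup>2 + (norm (g x))\<^sup>2)"
    by (intro AE_I2) simp
qed (use f g in measurable)

lemma L2_disk_mult_integrable:
  fixes f g :: "real^2 \<Rightarrow> real"
  shows "L2_disk f \<Longrightarrow> L2_disk g \<Longrightarrow> integrable \<mu> (\<lambda>x. f x * g x)"
  using L2_disk_inner_integrable[of f g] by simp

text \<open>The discriminant argument: the square of the norm of \<open>f - t g\<close> is a
  nonnegative quadratic polynomial in \<open>t\<close>.\<close>

lemma L2_Cauchy_Schwarz:
  assumes f: "L2_disk f" and g: "L2_disk g"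
  shows "\<bar>LINT x|\<mu>. f x \<bullet> g x\<bar> \<le> L2_norm_disk f * L2_norm_disk g"
proof -
  define a b c where "a = (L2_norm_disk f)\<^sup>2" "b = (L2_norm_disk g)\<^sup>2" "c = (LINT x|\<mu>. f x \<bullet> g x)"
  note abc = this
  note [simp] = L2_disk_integrable[OF f] L2_disk_integrable[OF g] L2_disk_inner_integrable[OF f g]
  have quad: "0 \<le> a - 2 * t * c + t\<^sup>2 * b" for t
  proof -
    have "0 \<le> (LINT x|\<mu>. (norm (f x - t *\<^sub>R g x))\<^sup>2)" by simp
    also have "(\<lambda>x. (norm (f x - t *\<^sub>R g x))\<^sup>2) =
        (\<lambda>x. (norm (f x))\<^sup>2 - (2 * t) * (f x \<bullet> g x) + t\<^sup>2 * (norm (g x))\<^sup>2)"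
      unfolding power2_norm_eq_inner inner_diff_left inner_diff_right
      by (simp add: inner_commute power2_eq_square algebra_simps fun_eq_iff)
    also have "(LINT x|\<mu>. \<dots> x) = a - 2 * t * c + t\<^sup>2 * b"
      by (simp add: abc L2_norm_square)
    finally show ?thesis .
  qed
  have "c\<^sup>2 \<le> a * b"
  proof (cases "b = 0")
    case True
    have "c = 0"
    proof (rule ccontr)
      assume "c \<noteq> 0"
      \<comment> \<open>With \<open>b = 0\<close> this \<open>t\<close> makes the polynomial equal
        to -1.\<close>
      then show False using quad[of "(a + 1) / (2 * c)"] True by simp
    qed
    then show ?thesis using True by simp
  next
    case False
    then have "b > 0" by (simp add: abc)
    \<comment> \<open>The minimiser of the quadratic polynomial.\<close>
    then show ?thesis using quad[of "c / b"] by (simp add: field_simps power2_eq_square)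
  qed
  then have "\<bar>c\<bar>\<^sup>2 \<le> (L2_norm_disk f * L2_norm_disk g)\<^sup>2"
    by (simp add: abc power_mult_distrib)
  then show ?thesis
    unfolding abc by (rule power2_le_imp_le) (simp add: L2_norm_nonneg)
qed

text \<open>Difference quotients in direction \<open>e\<close> have integral 0 by translation
  invariance, and they converge dominatedly to \<open>D\<close>. This avoids iterated
  integrals.\<close>

lemma integral_directional_derivative:
  fixes f D :: "real^2 \<Rightarrow> real"
  assumes deriv: "\<And>x. ((\<lambda>t. f (x + t *\<^sub>R e)) has_real_derivative D x) (at 0)"
    and cont: "continuous_on UNIV f" "continuous_on UNIV D"
    and out: "\<And>x. norm x \<ge> 1 \<Longrightarrow> f x = 0" "\<And>x. norm x \<ge> 1 \<Longrightarrow> D x = 0"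
    and e: "norm e = 1"
  shows "(LINT x|\<mu>. D x) = 0"
proof -
  have [measurable]: "f \<in> borel_measurable borel" "D \<in> borel_measurable borel"
    using cont by (auto intro: borel_measurable_continuous_onI)
  have "\<exists>B. \<forall>x. norm (g x) \<le> B" if "continuous_on UNIV g" "\<And>x. norm x \<ge> 1 \<Longrightarrow> g x = 0"
    for g :: "real^2 \<Rightarrow> real"
  proof -
    have "compact (g ` cball 0 1)"
      using that(1) by (intro compact_continuous_image) (auto intro: continuous_on_subset)
    then obtain B where B: "\<And>x. x \<in> cball 0 1 \<Longrightarrow> norm (g x) \<le> B"
      by (meson bounded_iff compact_imp_bounded image_eqI)
    then have "norm (g x) \<le> max B 0" for x
      using that(2)[of x] by (cases "norm x \<le> 1") (force simp: le_max_iff_disj)+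
    then show ?thesis by blast
  qed
  then obtain B B' where B: "\<And>x. \<bar>D x\<bar> \<le> B" and B': "\<And>x. \<bar>f x\<bar> \<le> B'"
    using cont out by (metis real_norm_def)
  have line: "((\<lambda>t. f (x + t *\<^sub>R e)) has_real_derivative D (x + s *\<^sub>R e)) (at s)" for x s
    using deriv[of "x + s *\<^sub>R e"] DERIV_at_within_shift[of "\<lambda>t. f (x + t *\<^sub>R e)" _ s 0 UNIV]
    by (simp add: algebra_simps)
  define h where "h n = inverse (real (Suc n))" for n
  have h: "0 < h n" "h n \<le> 1" for n by (auto simp: h_def field_simps)
  have f_int: "integrable lborel f"
    by (rule integrableI_bounded_set[of "cball 0 1" _ _ B'])
       (use B' out in \<open>auto simp: emeasure_bounded_finite[simplified]\<close>)
  have trans: "integrable lborel (\<lambda>x. f (x + c))" "(LINT x|lborel. f (x + c)) = (LINT x|lborel. f x)" for c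
  proof -
    have "integrable (distr lborel borel ((+) c)) f" by (simp add: lborel_distr_plus f_int)
    then show "integrable lborel (\<lambda>x. f (x + c))"
      by (simp add: integrable_distr_eq add.commute)
    have "(LINT x|lborel. f x) = (LINT x|distr lborel borel ((+) c). f x)"
      by (simp add: lborel_distr_plus)
    then show "(LINT x|lborel. f (x + c)) = (LINT x|lborel. f x)"
      by (simp add: integral_distr add.commute)
  qed
  \<comment> \<open>Inside radius 2 the mean value theorem bounds the quotient by \<open>B\<close>;
    outside, a shift by at most 1 stays off the unit disk, where \<open>f\<close> vanishes.\<close>
  have bound: "\<bar>(f (x + h n *\<^sub>R e) - f x) / h n\<bar> \<le> indicator (cball 0 2) x * B" for n x
  proof (cases "norm x \<le> 2")
    case True
    obtain z where "f (x + h n *\<^sub>R e) - f (x + 0 *\<^sub>R e) = (h n - 0) * D (x + z *\<^sub>R e)"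
      using MVT2[OF h(1)[of n], of "\<lambda>t. f (x + t *\<^sub>R e)" "\<lambda>s. D (x + s *\<^sub>R e)"] line by blast
    then show ?thesis using True B h(1)[of n] by simp
  next
    case False
    have "norm x - norm (h n *\<^sub>R e) \<le> norm (x + h n *\<^sub>R e)"
      by (metis add_diff_cancel norm_triangle_ineq2 norm_minus_cancel diff_minus_eq_add)
    then have "norm (x + h n *\<^sub>R e) \<ge> 1" using False h[of n] e by simp
    then show ?thesis using False out by simp
  qed
  have "(\<lambda>n. LINT x|lborel. (f (x + h n *\<^sub>R e) - f x) / h n) \<longlonglongrightarrow> (LINT x|lborel. D x)"
  proof (rule integral_dominated_convergence[where w = "\<lambda>x. indicator (cball 0 2) x * B"])
    show "integrable lborel (\<lambda>x::real^2. indicator (cball 0 2) x * B)"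
      by (auto simp: emeasure_bounded_finite[simplified])
    have "h \<longlonglongrightarrow> 0" unfolding h_def by (rule LIMSEQ_inverse_real_of_nat)
    then have hlim: "filterlim h (at 0) sequentially"
      using h(1) by (auto simp: filterlim_at less_imp_neq[symmetric])
    have "(\<lambda>n. (f (x + h n *\<^sub>R e) - f x) / h n) \<longlonglongrightarrow> D x" for x
      using filterlim_compose[OF deriv[of x, unfolded DERIV_def] hlim] by simp
    then show "AE x in lborel. (\<lambda>n. (f (x + h n *\<^sub>R e) - f x) / h n) \<longlonglongrightarrow> D x" by simp
  qed (use bound in auto)
  moreover have "(\<lambda>n. LINT x|lborel. (f (x + h n *\<^sub>R e) - f x) / h n) = (\<lambda>n. 0)"
    using trans f_int by (intro ext) simp
  ultimately have "(LINT x|lborel. D x) = 0"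
    by (metis LIMSEQ_unique tendsto_const)
  then show ?thesis
    using out(2) by (subst integral_disk_eq_lborel) auto
qed

lemma partial_deriv_along_axis:
  assumes "f differentiable (at x)"
  shows "((\<lambda>t. f (x + t *\<^sub>R axis i 1)) has_real_derivative partial_deriv i f x) (at 0)"
proof -
  have "(f has_derivative frechet_derivative f (at x)) (at (x + 0 *\<^sub>R axis i 1))"
    using assms by (simp add: frechet_derivative_works)
  moreover have "((\<lambda>t. x + t *\<^sub>R axis i 1) has_derivative (\<lambda>t. t *\<^sub>R axis i 1)) (at (0::real))"
    by (auto intro!: derivative_eq_intros)
  ultimately have "((\<lambda>t. f (x + t *\<^sub>R axis i 1)) has_derivative
      (\<lambda>t. frechet_derivative f (at x) (t *\<^sub>R axis i 1))) (at 0)"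
    by (rule has_derivative_compose[rotated])
  moreover have "frechet_derivative f (at x) (t *\<^sub>R axis i 1) = partial_deriv i f x * t" for t
    using linear_frechet_derivative[OF assms] by (simp add: linear_scale partial_deriv_def)
  ultimately show ?thesis
    by (simp add: has_field_derivative_def)
qed

definition grad :: "(real^2 \<Rightarrow> real) \<Rightarrow> real^2 \<Rightarrow> real^2" where
  "grad f x = (\<chi> i. partial_deriv i f x)"

lemma test_function_grad_continuous: "test_function \<phi> \<Longrightarrow> continuous_on UNIV (grad \<phi>)"
  unfolding grad_def by (intro continuous_intros test_function_partial_continuous)

text \<open>The product \<open>g \<phi>\<close> vanishes off the disk, so its directional derivative
  integrates to 0. Only the derivative along one axis is asked of \<open>g\<close>, which serves
  both test functions and the components of the explicit field \<open>\<Phi>\<close>.\<close>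

lemma integral_by_parts:
  assumes \<phi>: "test_function \<phi>"
    and deriv: "\<And>x. ((\<lambda>t. g (x + t *\<^sub>R axis i 1)) has_real_derivative D x) (at 0)"
    and cont: "continuous_on UNIV g" "continuous_on UNIV D"
  shows "(LINT x|\<mu>. g x * partial_deriv i \<phi> x) = - (LINT x|\<mu>. D x * \<phi> x)"
proof -
  note c = test_function_continuous[OF \<phi>] test_function_partial_continuous[OF \<phi>]
  have "(LINT x|\<mu>. D x * \<phi> x + partial_deriv i \<phi> x * g x) = 0"
  proof (rule integral_directional_derivative[where f = "\<lambda>x. g x * \<phi> x" and e = "axis i 1"])
    show "((\<lambda>t. g (x + t *\<^sub>R axis i 1) * \<phi> (x + t *\<^sub>R axis i 1)) has_real_derivative
        D x * \<phi> x + partial_deriv i \<phi> x * g x) (at 0)" for x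
      using DERIV_mult[OF deriv partial_deriv_along_axis[OF test_function_differentiable[OF \<phi>]]]
      by simp
  qed (use \<phi> c cont test_function_outside in \<open>auto intro!: continuous_intros\<close>)
  moreover have "integrable \<mu> (\<lambda>x. D x * \<phi> x)" "integrable \<mu> (\<lambda>x. g x * partial_deriv i \<phi> x)"
    by (intro L2_disk_mult_integrable L2_disk_continuous c cont)+
  ultimately show ?thesis
    by (simp add: mult.commute)
qed

lemma test_function_weak_gradient:
  assumes \<phi>: "test_function \<phi>" shows "is_weak_gradient \<phi> (grad \<phi>)"
  unfolding is_weak_gradient_def
proof (intro conjI allI impI)
  show "L2_disk (grad \<phi>)"
    by (intro L2_disk_continuous test_function_grad_continuous \<phi>)
  show "(LINT x|\<mu>. \<phi> x * partial_deriv i \<psi> x) = - (LINT x|\<mu>. (grad \<phi> x $ i) * \<psi> x)"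
    if "test_function \<psi>" for \<psi> i
    using integral_by_parts[OF that partial_deriv_along_axis[OF test_function_differentiable[OF \<phi>]]]
      test_function_continuous[OF \<phi>] test_function_partial_continuous[OF \<phi>]
    by (simp add: grad_def)
qed

section \<open>Uniqueness of weak gradients\<close>

lemma flat_0_bounds: "0 \<le> flat 0 s" "flat 0 s \<le> 1" "flat 0 s = 0 \<longleftrightarrow> s \<le> 0"
  by (auto simp: flat_def)

lemma flat_continuous: "continuous_on UNIV (flat n)"
  using flat_derivative DERIV_isCont by (blast intro: continuous_at_imp_continuous_on)

text \<open>Smooth approximation of a half-line: for \<open>s > 0\<close> the values are
  \<open>exp (-1/((n+1) s))\<close>.\<close>

lemma flat_0_tendsto_indicator:
  "(\<lambda>n. flat 0 (real (Suc n) * s)) \<longlonglongrightarrow> indicator {0<..} s"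
proof (cases "s > 0")
  case True
  have "(\<lambda>n. exp (- (inverse (real (Suc n)) * inverse s))) \<longlonglongrightarrow> exp (- (0 * inverse s))"
    by (intro tendsto_intros LIMSEQ_inverse_real_of_nat)
  then show ?thesis
    using True by (simp add: flat_def mult_pos_pos)
next
  case False
  then have "flat 0 (real (Suc n) * s) = 0" for n
    by (simp add: flat_0_bounds mult_nonneg_nonpos)
  then show ?thesis using False by simp
qed

text \<open>The indicator of a box is not an admissible test function: it is not smooth, and the box
  may leave the disk. It is approximated by smooth products cut off inside the disk; the limit of
  the cutoff remains as a weight.\<close>

lemma integral_weighted_box_zero:
  assumes g: "integrable \<mu> g"
    and zero: "\<And>\<phi>. test_function \<phi> \<Longrightarrow> (LINT x|\<mu>. g x * \<phi> x) = 0"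
  shows "(LINT x|\<mu>. indicator (box a b) x * (g x * flat 0 (1 - (norm x)\<^sup>2))) = 0"
proof -
  \<comment> \<open>Four factors for the sides of the box; the last factor confines the support to
    radius \<open>sqrt (1 - 1/(n+1))\<close>, which is below 1.\<close>
  define \<phi> where "\<phi> n x = flat 0 (real (Suc n) * (x $ 1 - a $ 1)) * flat 0 (real (Suc n) * (b $ 1 - x $ 1)) *
      flat 0 (real (Suc n) * (x $ 2 - a $ 2)) * flat 0 (real (Suc n) * (b $ 2 - x $ 2)) *
      flat 0 ((1 - inverse (real (Suc n))) - (norm x)\<^sup>2)" for n and x :: "real^2"
  have test: "test_function (\<phi> n)" for n
  proof (rule test_functionI[where \<rho> = "sqrt (1 - inverse (real (Suc n)))"])
    show "smooth_expr (\<phi> n)"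
      unfolding \<phi>_def by (intro smooth_expr.intros smooth_expr_diff smooth_expr_norm_square)
    show "norm x \<le> sqrt (1 - inverse (real (Suc n)))" if "\<phi> n x \<noteq> 0" for x
      using that by (intro real_le_rsqrt) (simp add: \<phi>_def flat_0_bounds)
  qed auto
  have \<phi>_le: "\<bar>\<phi> n x\<bar> \<le> 1" for n x
    unfolding \<phi>_def abs_mult
    by (intro mult_le_one mult_nonneg_nonneg) (auto simp: flat_0_bounds)
  have lim: "(\<lambda>n. \<phi> n x) \<longlonglongrightarrow> indicator (box a b) x * flat 0 (1 - (norm x)\<^sup>2)" for x
  proof -
    have "(\<lambda>n. (1 - inverse (real (Suc n))) - (norm x)\<^sup>2) \<longlonglongrightarrow> 1 - 0 - (norm x)\<^sup>2"
      by (intro tendsto_intros LIMSEQ_inverse_real_of_nat)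
    then have "(\<lambda>n. flat 0 ((1 - inverse (real (Suc n))) - (norm x)\<^sup>2)) \<longlonglongrightarrow> flat 0 (1 - (norm x)\<^sup>2)"
      using continuous_on_tendsto_compose[OF flat_continuous] by fastforce
    then have "(\<lambda>n. \<phi> n x) \<longlonglongrightarrow> indicator {0<..} (x $ 1 - a $ 1) * indicator {0<..} (b $ 1 - x $ 1) *
        indicator {0<..} (x $ 2 - a $ 2) * indicator {0<..} (b $ 2 - x $ 2) * flat 0 (1 - (norm x)\<^sup>2)"
      unfolding \<phi>_def by (intro tendsto_mult flat_0_tendsto_indicator)
    moreover have "indicator {0<..} (x $ 1 - a $ 1) * indicator {0<..} (b $ 1 - x $ 1) *
        indicator {0<..} (x $ 2 - a $ 2) * indicator {0<..} (b $ 2 - x $ 2) = indicat_real (box a b) x"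
      by (auto simp: indicator_def mem_box_cart forall_2)
    ultimately show ?thesis by simp
  qed
  have [measurable]: "\<phi> n \<in> borel_measurable \<mu>" for n
    by (intro continuous_imp_measurable_disk test_function_continuous test)
  have [measurable]: "g \<in> borel_measurable \<mu>" using g by simp
  have "(\<lambda>n. LINT x|\<mu>. g x * \<phi> n x) \<longlonglongrightarrow>
      (LINT x|\<mu>. indicator (box a b) x * (g x * flat 0 (1 - (norm x)\<^sup>2)))"
  proof (rule integral_dominated_convergence[where w = "\<lambda>x. \<bar>g x\<bar>"])
    show "AE x in \<mu>. (\<lambda>n. g x * \<phi> n x) \<longlonglongrightarrow> indicator (box a b) x * (g x * flat 0 (1 - (norm x)\<^sup>2))"
      by (intro AE_I2) (use tendsto_mult[OF tendsto_const lim] in \<open>simp add: ac_simps\<close>)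
    show "(\<lambda>x. indicator (box a b) x * (g x * flat 0 (1 - (norm x)\<^sup>2))) \<in> borel_measurable \<mu>"
      by (rule borel_measurable_LIMSEQ_metric[where f = "\<lambda>n x. g x * \<phi> n x"])
         (use tendsto_mult[OF tendsto_const lim] in \<open>simp_all add: ac_simps\<close>)
    show "AE x in \<mu>. norm (g x * \<phi> n x) \<le> \<bar>g x\<bar>" for n
      using \<phi>_le by (intro AE_I2) (simp add: abs_mult mult_left_le)
  qed (use g in \<open>simp_all\<close>)
  moreover have "(\<lambda>n. LINT x|\<mu>. g x * \<phi> n x) = (\<lambda>n. 0)"
    by (intro ext zero test)
  ultimately show ?thesis
    by (simp only: LIMSEQ_const_iff)
qed

text \<open>Boxes form an intersection-stable generator of the Borel sets, so the integral of
  \<open>k\<close> vanishes over all Borel sets, and over all Lebesgue sets after discarding a null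
  set; then the density \<open>k\<close> is 0 almost everywhere.\<close>

lemma AE_zero_if_integral_boxes_zero:
  fixes k :: "real^2 \<Rightarrow> real"
  assumes k: "integrable \<mu> k" and zero: "\<And>a b. (LINT x|\<mu>. indicator (box a b) x * k x) = 0"
  shows "AE x in \<mu>. k x = 0"
proof (rule sigma_finite_measure.density_zero[OF _ k])
  show "sigma_finite_measure \<mu>"
    using finite_measure_disk by (rule finite_measure.axioms(1))
  let ?G = "range (\<lambda>(a, b). box a b :: (real^2) set)"
  have [measurable]: "k \<in> borel_measurable \<mu>" using k by simp
  have sub: "A \<inter> disk \<in> sets \<mu>" if "A \<in> sets lebesgue" for A
    using that by (auto simp: sets_restrict_space Int_commute)
  have meas: "indicat_real A \<in> borel_measurable \<mu>" if "A \<in> sets lebesgue" for A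
    using that by (intro measurable_restrict_space1) auto
  have int: "integrable \<mu> (\<lambda>x. indicator A x * k x)" if "A \<in> sets lebesgue" for A
    by (rule Bochner_Integration.integrable_bound[OF k borel_measurable_times[OF meas[OF that]]])
       (auto simp: indicator_def)
  \<comment> \<open>Needed for complements; the disk lies in the box with corners (-1,-1) and
    (1,1).\<close>
  have all: "(LINT x|\<mu>. k x) = 0"
  proof -
    have "disk \<subseteq> box (\<chi> i. -1) (\<chi> i. 1)"
    proof
      fix x :: "real^2" assume "x \<in> disk"
      then have "\<bar>x $ i\<bar> < 1" for i
        using component_le_norm_cart[of x i] by simp
      then show "x \<in> box (\<chi> i. -1) (\<chi> i. 1)"
        by (simp add: mem_box_cart abs_less_iff minus_less_iff)
    qed
    then have "(LINT x|\<mu>. k x) = (LINT x|\<mu>. indicator (box (\<chi> i. -1) (\<chi> i. 1)) x * k x)"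
      by (intro Bochner_Integration.integral_cong) (auto simp: indicator_def)
    then show ?thesis by (simp add: zero)
  qed
  have sets: "sets borel = sigma_sets UNIV ?G" by (subst borel_eq_box) auto
  have stable: "Int_stable ?G" "?G \<subseteq> Pow UNIV"
    by (auto simp: Int_stable_def box_Int_box)
  have borel: "(LINT x|\<mu>. indicator A x * k x) = 0" if "A \<in> sets borel" for A
    using stable that[unfolded sets]
  proof (induction rule: sigma_sets_induct_disjoint)
    case (basic A)
    then show ?case using zero by auto
  next
    case (compl A)
    then have "A \<in> sets lebesgue" unfolding sets[symmetric] by simp
    have "(\<lambda>x. indicator (UNIV - A) x * k x) = (\<lambda>x. k x - indicator A x * k x)"
      by (auto simp: indicator_def)
    then show ?case
      using compl int[OF \<open>A \<in> sets lebesgue\<close>] k all by simp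
  next
    case (union A)
    have A: "A i \<in> sets lebesgue" for i
      using union(2) unfolding sets[symmetric] by auto
    have "(LINT x|\<mu>. indicator (\<Union>i. A i) x * k x) = (LINT x:(\<Union>i. A i \<inter> disk)|\<mu>. k x)"
      unfolding set_lebesgue_integral_def
      by (intro Bochner_Integration.integral_cong) (auto simp: indicator_def)
    also have "\<dots> = (\<Sum>i. LINT x:(A i \<inter> disk)|\<mu>. k x)"
    proof (rule lebesgue_integral_countable_add)
      show "set_integrable \<mu> (\<Union>i. A i \<inter> disk) k"
        unfolding set_integrable_def
        by (intro integrable_mult_indicator k sets.countable_UN) (use sub[OF A] in blast)
      show "A i \<inter> disk \<in> sets \<mu>" for i by (rule sub[OF A])
      show "(A i \<inter> disk) \<inter> (A j \<inter> disk) = {}" if "i \<noteq> j" for i j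
        using union(1) that unfolding disjoint_family_on_def by blast
    qed
    also have "\<dots> = (\<Sum>i. 0)"
    proof (rule suminf_cong)
      fix i
      have "(LINT x:(A i \<inter> disk)|\<mu>. k x) = (LINT x|\<mu>. indicator (A i) x * k x)"
        unfolding set_lebesgue_integral_def
        by (intro Bochner_Integration.integral_cong) (auto simp: indicator_def)
      then show "(LINT x:(A i \<inter> disk)|\<mu>. k x) = 0" using union(3) by simp
    qed
    finally show ?case by simp
  qed simp
  \<comment> \<open>A Lebesgue set is a Borel set \<open>S\<close> up to a subset of a Borel null
    set.\<close>
  fix A assume A: "A \<in> sets \<mu>"
  then have "A \<in> sets lebesgue"
    by (simp add: sets_restrict_space_iff)
  then obtain S N N' where S: "A = S \<union> N" "N \<subseteq> N'" "N' \<in> null_sets lborel" "S \<in> sets lborel"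
    by (rule sets_completionE)
  have "AE x in lebesgue. x \<notin> N'"
    using S(3) by (intro AE_not_in null_sets_completionI)
  then have "AE x in \<mu>. x \<notin> N'"
    by (subst AE_restrict_space_iff) auto
  then have "AE x in \<mu>. indicator A x * k x = indicator S x * k x"
    by eventually_elim (use S in \<open>auto simp: indicator_def\<close>)
  then have "(LINT x|\<mu>. indicator A x * k x) = (LINT x|\<mu>. indicator S x * k x)"
    using meas[of A] meas[of S] \<open>A \<in> sets lebesgue\<close> S(4) by (intro integral_cong_AE) auto
  then show "set_lebesgue_integral \<mu> A k = 0"
    using borel[of S] S(4) by (simp add: set_lebesgue_integral_def)
qed

lemma fundamental_lemma:
  assumes g: "L2_disk g"
    and zero: "\<And>\<phi>. test_function \<phi> \<Longrightarrow> (LINT x|\<mu>. g x * \<phi> x) = 0"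
  shows "AE x in \<mu>. g x = (0::real)"
proof -
  have c: "continuous_on UNIV (\<lambda>x::real^2. flat 0 (1 - (norm x)\<^sup>2))"
    by (intro smooth_expr_continuous smooth_expr.intros smooth_expr_diff smooth_expr_norm_square)
  have "integrable \<mu> (\<lambda>x. g x * 1)"
    by (intro L2_disk_mult_integrable g L2_disk_continuous continuous_on_const)
  then have "AE x in \<mu>. g x * flat 0 (1 - (norm x)\<^sup>2) = 0"
    using zero by (intro AE_zero_if_integral_boxes_zero integral_weighted_box_zero
        L2_disk_mult_integrable L2_disk_continuous g c) auto
  \<comment> \<open>The weight \<open>flat 0 (1 - (norm x)\<^sup>2)\<close> is strictly positive on
    the open disk and can be divided out.\<close>
  then show ?thesis
  proof (rule AE_mp, intro AE_I2 impI)
    fix x assume "x \<in> space \<mu>" "g x * flat 0 (1 - (norm x)\<^sup>2) = 0"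
    moreover from this have "(norm x)\<^sup>2 < 1" by (simp add: abs_square_less_1)
    ultimately show "g x = 0" by (simp add: flat_0_bounds)
  qed
qed

lemma L2_disk_component:
  fixes F :: "real^2 \<Rightarrow> real^2"
  assumes F: "L2_disk F" shows "L2_disk (\<lambda>x. F x $ i)"
proof -
  have "(\<lambda>x. F x $ i) \<in> borel_measurable \<mu>"
    using borel_measurable_inner[OF L2_disk_measurable[OF F] borel_measurable_const[of "axis i 1"]]
    by (simp add: inner_axis)
  moreover from this have "integrable \<mu> (\<lambda>x. (norm (F x $ i))\<^sup>2)"
  proof (intro Bochner_Integration.integrable_bound[OF L2_disk_integrable[OF F]] AE_I2)
    show "norm ((norm (F x $ i))\<^sup>2) \<le> norm ((norm (F x))\<^sup>2)" for x
      using power_mono[OF component_le_norm_cart[of "F x" i], of 2] by simp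
  qed measurable
  ultimately show ?thesis
    unfolding L2_disk_def ..
qed

text \<open>Each component of \<open>G - H\<close> integrates to 0 against every test function, so
  the fundamental lemma applies.\<close>

lemma weak_gradient_unique:
  assumes G: "is_weak_gradient u G" and H: "is_weak_gradient u H"
  shows "AE x in \<mu>. G x = H x"
proof -
  have L: "L2_disk G" "L2_disk H" using G H by (auto simp: is_weak_gradient_def)
  have "AE x in \<mu>. G x $ i - H x $ i = 0" for i
  proof (rule fundamental_lemma)
    show "L2_disk (\<lambda>x. G x $ i - H x $ i)" by (intro L2_disk_diff L2_disk_component L)
    fix \<phi> assume \<phi>: "test_function \<phi>"
    have "integrable \<mu> (\<lambda>x. F x $ i * \<phi> x)" if "L2_disk F" for F
      by (intro L2_disk_mult_integrable L2_disk_component that L2_disk_continuous test_function_continuous \<phi>)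
    then show "(LINT x|\<mu>. (G x $ i - H x $ i) * \<phi> x) = 0"
      using G H L \<phi> unfolding is_weak_gradient_def left_diff_distrib
      by simp
  qed
  then have "AE x in \<mu>. \<forall>i\<in>UNIV. G x $ i - H x $ i = 0"
    by (intro AE_finite_allI) auto
  then show ?thesis
    by (rule AE_mp, intro AE_I2) (simp add: vec_eq_iff)
qed

lemma weak_gradient_works: "is_weak_gradient u G \<Longrightarrow> is_weak_gradient u (weak_gradient u)"
  unfolding weak_gradient_def by (rule someI[where P = "is_weak_gradient u"])

text \<open>Lets the norm, defined through a chosen gradient, be computed from any explicit weak
  gradient.\<close>

lemma H10_norm_eq:
  assumes "is_weak_gradient u G" shows "H10_norm u = L2_norm_disk G"
  unfolding H10_norm_def
  using weak_gradient_works[OF assms] assms weak_gradient_unique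
  by (intro L2_norm_cong_AE) (auto simp: is_weak_gradient_def)

lemma H1_norm_eq:
  assumes "is_weak_gradient u G"
  shows "H1_norm u = sqrt ((L2_norm_disk u)\<^sup>2 + (L2_norm_disk G)\<^sup>2)"
  using H10_norm_eq[OF assms] by (simp add: H1_norm_def H10_norm_def)

section \<open>The pointwise bound for radial functions\<close>

text \<open>A substitute for polar coordinates: a disk of radius \<open>sqrt t\<close> has area
  \<open>pi * t\<close>, so the variable \<open>s = (norm x)\<^sup>2\<close> has constant density.
  Two finite measures on the line are compared on the half-lines \<open>{t<..}\<close>.\<close>

lemma disk_distr_norm_square:
  "distr \<mu> borel (\<lambda>x. (norm x)\<^sup>2) = density lborel (\<lambda>s. ennreal (pi * indicator {0..1} s))"
proof (rule measure_eqI_lessThan)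
  have [measurable]: "(\<lambda>x::real^2. (norm x)\<^sup>2) \<in> borel_measurable \<mu>"
    by (intro continuous_imp_measurable_disk continuous_intros)
  interpret finite_measure \<mu> by (rule finite_measure_disk)
  show "emeasure (distr \<mu> borel (\<lambda>x. (norm x)\<^sup>2)) {t<..} < \<infinity>" for t
    by (subst emeasure_distr) (auto simp: less_top[symmetric])
  show "emeasure (distr \<mu> borel (\<lambda>x. (norm x)\<^sup>2)) {t<..} =
      emeasure (density lborel (\<lambda>s. ennreal (pi * indicator {0..1} s))) {t<..}" for t :: real
  proof -
    define A where "A = {x::real^2. norm x < 1 \<and> t < (norm x)\<^sup>2}"
    have "open {x::real^2. norm x < 1 \<and> t < (norm x)\<^sup>2}"
      by (intro open_Collect_conj open_Collect_less continuous_intros)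
    then have A: "A \<in> sets borel" by (simp add: A_def)
    have "emeasure (distr \<mu> borel (\<lambda>x. (norm x)\<^sup>2)) {t<..} = emeasure lborel A"
    proof (subst emeasure_distr)
      have "(\<lambda>x::real^2. (norm x)\<^sup>2) -` {t<..} \<inter> space \<mu> = A"
        by (auto simp: A_def)
      moreover have "emeasure \<mu> A = emeasure lborel A"
        using A by (subst emeasure_restrict_space) (auto simp: A_def)
      ultimately show "emeasure \<mu> ((\<lambda>x. (norm x)\<^sup>2) -` {t<..} \<inter> space \<mu>) = emeasure lborel A"
        by simp
    qed auto
    also have "emeasure lborel A = ennreal pi * emeasure lborel ({0..1} \<inter> {t<..})"
    proof -
      consider "t < 0" | "0 \<le> t" "t < 1" | "t \<ge> 1" by linarith
      then show ?thesis
      proof cases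
        case 1
        have "A = ball 0 1"
          using 1 by (auto simp: A_def intro: less_le_trans[OF _ zero_le_power2])
        moreover have "{0..1} \<inter> {t<..} = {0..1}" using 1 by auto
        ultimately show ?thesis
          by (simp add: emeasure_ball unit_ball_vol_numeral)
      next
        case 2
        have "norm x \<le> sqrt t \<longleftrightarrow> (norm x)\<^sup>2 \<le> t" for x :: "real^2"
          using 2 by (metis norm_ge_zero real_sqrt_abs real_sqrt_le_iff abs_norm_cancel)
        then have "A = ball 0 1 - cball 0 (sqrt t)"
          by (auto simp: A_def not_le)
        moreover have "emeasure lborel (ball 0 1 - cball 0 (sqrt t) :: (real^2) set) =
            emeasure lborel (ball 0 1 :: (real^2) set) - emeasure lborel (cball 0 (sqrt t) :: (real^2) set)"
        proof (intro emeasure_Diff)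
          show "cball 0 (sqrt t) \<subseteq> (ball 0 1 :: (real^2) set)"
          proof -
            have "sqrt t < 1" using 2 by simp
            then show ?thesis by (auto simp del: real_sqrt_lt_1_iff)
          qed
        qed (use 2 in \<open>auto simp: emeasure_cball\<close>)
        moreover have "{0..1} \<inter> {t<..} = {t<..1}" using 2 by auto
        ultimately show ?thesis
          using 2 by (simp add: emeasure_ball emeasure_cball unit_ball_vol_numeral ennreal_minus
              ennreal_mult[symmetric] right_diff_distrib)
      next
        case 3
        have "x \<notin> A" for x
          using 3 power_le_one[of "norm x" 2] by (auto simp: A_def)
        then have "A = {}" by blast
        moreover have "{0..1} \<inter> {t<..} = {}" using 3 by auto
        ultimately show ?thesis by simp
      qed
    qed
    also have "\<dots> = emeasure (density lborel (\<lambda>s. ennreal (pi * indicator {0..1} s))) {t<..}"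
      by (subst emeasure_density)
         (auto simp: ennreal_mult ennreal_indicator mult.assoc nn_integral_cmult
             indicator_inter_arith[symmetric])
    finally show ?thesis .
  qed
qed auto

lemma integral_radial:
  fixes f :: "real \<Rightarrow> real"
  assumes [measurable]: "f \<in> borel_measurable borel"
  shows "(LINT x|\<mu>. f ((norm x)\<^sup>2)) = pi * (LINT s|lborel. f s * indicator {0..1} s)"
proof -
  have "(\<lambda>x::real^2. (norm x)\<^sup>2) \<in> borel_measurable \<mu>"
    by (intro continuous_imp_measurable_disk continuous_intros)
  then have "(LINT x|\<mu>. f ((norm x)\<^sup>2)) = (LINT s|distr \<mu> borel (\<lambda>x. (norm x)\<^sup>2). f s)"
    by (simp add: integral_distr)
  also have "\<dots> = (LINT s|lborel. pi * (f s * indicator {0..1} s))"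
    unfolding disk_distr_norm_square
    by (subst integral_density) (auto simp: ac_simps)
  finally show ?thesis by simp
qed

text \<open>The derivative is a tent over \<open>[a, b]\<close> with peak \<open>1/d\<close> at the
  midpoint and area 1; \<open>h\<close> is its primitive. One continuous derivative is what the flux
  computation consumes.\<close>

lemma C1_step_function:
  fixes a b :: real
  assumes "a < b"
  obtains h h' where "\<And>s. (h has_real_derivative h' s) (at s)" "continuous_on UNIV h'"
    "\<And>s. 0 \<le> h' s" "\<And>s. s \<notin> {a<..<b} \<Longrightarrow> h' s = 0"
    "\<And>s. s \<le> a \<Longrightarrow> h s = 0" "\<And>s. s \<ge> b \<Longrightarrow> h s = 1" "\<And>s. 0 \<le> h s" "\<And>s. h s \<le> 1"
proof -
  define d m where "d = (b - a) / 2" and "m = (a + b) / 2"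
  have d: "d > 0" "m = a + d" "b = a + 2 * d" using assms by (auto simp: d_def m_def field_simps)
  \<comment> \<open>Half of \<open>p\<close> is a primitive of \<open>max 0 s\<close>; second
    differences of shifts of \<open>max 0 s\<close> are tents.\<close>
  define p :: "real \<Rightarrow> real" where "p s = (max 0 s)\<^sup>2" for s
  have p: "(p has_real_derivative 2 * max 0 s) (at s)" for s
  proof (cases "s = 0")
    case True
    have "(\<lambda>y. (p (0 + y) - p 0) / y) = max 0"
      by (auto simp: p_def fun_eq_iff max_def power2_eq_square)
    moreover have "((\<lambda>y. max 0 y) \<longlongrightarrow> max 0 0) (at (0::real))"
      by (intro tendsto_intros)
    ultimately show ?thesis using True by (simp add: DERIV_def)
  next
    case False
    then consider "s > 0" | "s < 0" by linarith
    then show ?thesis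
    proof cases
      case 1
      have "((\<lambda>s. s\<^sup>2) has_real_derivative 2 * max 0 s) (at s)"
        using 1 by (auto intro!: derivative_eq_intros)
      then show ?thesis
        by (rule has_field_derivative_transform_within_open[of _ _ _ "{0<..}"])
           (use 1 in \<open>auto simp: p_def\<close>)
    next
      case 2
      have "((\<lambda>s. 0) has_real_derivative 2 * max 0 s) (at s)"
        using 2 by simp
      then show ?thesis
        by (rule has_field_derivative_transform_within_open[of _ _ _ "{..<0}"])
           (use 2 in \<open>auto simp: p_def\<close>)
    qed
  qed
  define h where "h s = (p (s - a) - 2 * p (s - m) + p (s - b)) / (2 * d\<^sup>2)" for s
  define h' where "h' s = (max 0 (s - a) - 2 * max 0 (s - m) + max 0 (s - b)) / d\<^sup>2" for s
  have deriv: "(h has_real_derivative h' s) (at s)" for s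
  proof -
    have q: "((\<lambda>s. p (s - c)) has_real_derivative 2 * max 0 (s - c)) (at s)" for c
    proof -
      have "((\<lambda>s. s - c) has_real_derivative 1) (at s)" by (auto intro!: derivative_eq_intros)
      from DERIV_chain2[OF p this] show ?thesis by simp
    qed
    have "((\<lambda>s. (p (s - a) - 2 * p (s - m) + p (s - b)) / (2 * d\<^sup>2)) has_real_derivative
        (2 * max 0 (s - a) - 2 * (2 * max 0 (s - m)) + 2 * max 0 (s - b)) / (2 * d\<^sup>2)) (at s)"
      by (intro DERIV_cdivide DERIV_add DERIV_diff DERIV_cmult q)
    also have "(2 * max 0 (s - a) - 2 * (2 * max 0 (s - m)) + 2 * max 0 (s - b)) / (2 * d\<^sup>2) = h' s"
      unfolding h'_def using d by (subst frac_eq_eq) (simp_all add: algebra_simps)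
    finally show ?thesis unfolding h_def .
  qed
  have nonneg: "0 \<le> h' s" for s
    using d by (auto simp: h'_def max_def)
  have left: "h s = 0" if "s \<le> a" for s
    using that d by (simp add: h_def p_def max_def)
  have right: "h s = 1" if "s \<ge> b" for s
  proof -
    have "max 0 (s - a) = s - a" "max 0 (s - m) = s - m" "max 0 (s - b) = s - b"
      using that d by auto
    then have "p (s - a) - 2 * p (s - m) + p (s - b) = 2 * d\<^sup>2"
      using d by (simp add: p_def power2_eq_square algebra_simps)
    then show ?thesis using d by (simp add: h_def)
  qed
  have mono: "h s \<le> h t" if "s \<le> t" for s t
    using DERIV_nonneg_imp_nondecreasing[OF that] deriv nonneg by blast
  show thesis
  proof (rule that[OF deriv _ nonneg _ left right])
    show "continuous_on UNIV h'"
      unfolding h'_def using d by (intro continuous_intros) auto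
    show "h' s = 0" if "s \<notin> {a<..<b}" for s
      using that d by (auto simp: h'_def max_def)
    show "0 \<le> h s" for s
      using mono[of "min a s" s] left[of "min a s"] by simp
    show "h s \<le> 1" for s
      using mono[of s "max b s"] right[of "max b s"] by simp
  qed
qed

lemma norm_square_along_axis:
  "((\<lambda>t. (norm (x + t *\<^sub>R axis i 1))\<^sup>2) has_real_derivative 2 * x $ i) (at 0)" for x :: "real^2"
proof -
  have "(\<lambda>t. (norm (x + t *\<^sub>R axis i 1))\<^sup>2) = (\<lambda>t. (norm x)\<^sup>2 + 2 * t * x $ i + t\<^sup>2)"
    unfolding power2_norm_eq_inner inner_add_left inner_add_right
    by (simp add: inner_axis inner_axis' power2_eq_square algebra_simps)
  moreover have "((\<lambda>t. (norm x)\<^sup>2 + 2 * t * x $ i + t\<^sup>2) has_real_derivative 2 * x $ i) (at 0)"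
    by (auto intro!: derivative_eq_intros)
  ultimately show ?thesis by simp
qed

section \<open>Flux of weak gradients against a radial field\<close>

locale radial_field =
  fixes a :: real and h h' :: "real \<Rightarrow> real"
  assumes a: "0 < a"
    and h_deriv: "\<And>s. (h has_real_derivative h' s) (at s)"
    and h'_cont: "continuous_on UNIV h'"
    and h_left: "\<And>s. s \<le> a \<Longrightarrow> h s = 0" "\<And>s. s \<le> a \<Longrightarrow> h' s = 0"
begin

text \<open>Since \<open>h\<close> vanishes on \<open>{..a}\<close>, the field \<open>\<Phi>\<close> is \<open>h (|x|\<^sup>2) x / |x|\<^sup>2\<close>; in the plane
  \<open>x / |x|\<^sup>2\<close> is divergence free, so \<open>\<Phi>\<close> has divergence \<open>2 h' (|x|\<^sup>2)\<close>.\<close>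

definition "k s = h s / max s a"
definition "k' s = h' s / max s a - h s / (max s a)\<^sup>2"
definition \<Phi> :: "real^2 \<Rightarrow> real^2" where "\<Phi> x = k ((norm x)\<^sup>2) *\<^sub>R x"

lemma h_cont: "continuous_on UNIV h"
  using h_deriv DERIV_isCont by (blast intro: continuous_at_imp_continuous_on)

lemma k_cont: "continuous_on UNIV k" "continuous_on UNIV k'"
  unfolding k_def k'_def using a by (intro continuous_intros h_cont h'_cont; auto)+

text \<open>The kink of \<open>max s a\<close> is harmless: \<open>k s\<close> equals
  \<open>h s / s\<close> on all of \<open>{0<..}\<close>, since both vanish for \<open>0 < s\<close>
  up to \<open>a\<close>.\<close>

lemma k_deriv: "(k has_real_derivative k' s) (at s)"
proof (cases "s < a")
  case True
  have "((\<lambda>s. 0) has_real_derivative k' s) (at s)"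
    using True by (simp add: k'_def h_left)
  then show ?thesis
    by (rule has_field_derivative_transform_within_open[of _ _ _ "{..<a}"])
       (use True in \<open>auto simp: k_def h_left\<close>)
next
  case False
  have "((\<lambda>s. h s / s) has_real_derivative k' s) (at s)"
    by (rule derivative_eq_intros h_deriv refl)+
       (use False a in \<open>auto simp: k'_def power2_eq_square field_simps\<close>)
  then show ?thesis
    by (rule has_field_derivative_transform_within_open[of _ _ _ "{0<..}"])
       (use False a in \<open>auto simp: k_def max_def h_left\<close>)
qed

lemma \<Phi>_cont: "continuous_on UNIV \<Phi>"
  unfolding \<Phi>_def by (intro continuous_intros continuous_on_compose2[OF k_cont(1)]) auto

lemma flux_test_function:
  assumes \<phi>: "test_function \<phi>"
  shows "(LINT x|\<mu>. \<phi> x * (2 * h' ((norm x)\<^sup>2))) = - (LINT x|\<mu>. grad \<phi> x \<bullet> \<Phi> x)"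
proof -
  \<comment> \<open>The \<open>i\<close>-th partial derivative of the component
    \<open>\<Phi> x $ i\<close>; the two of them add up to the divergence.\<close>
  define D where "D i x = k ((norm x)\<^sup>2) + 2 * (x $ i)\<^sup>2 * k' ((norm x)\<^sup>2)" for i :: 2 and x :: "real^2"
  have \<Phi>_i: "\<Phi> x $ i = k ((norm x)\<^sup>2) * x $ i" for x i
    by (simp add: \<Phi>_def)
  have D_cont: "continuous_on UNIV (D i)" for i
    unfolding D_def
    by (intro continuous_intros continuous_on_compose2[OF k_cont(1)] continuous_on_compose2[OF k_cont(2)]) auto
  have \<Phi>_i_cont: "continuous_on UNIV (\<lambda>x. \<Phi> x $ i)" for i
    by (intro continuous_intros \<Phi>_cont)
  have "((\<lambda>t. \<Phi> (x + t *\<^sub>R axis i 1) $ i) has_real_derivative D i x) (at 0)" for x i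
  proof -
    have "((\<lambda>t. k ((norm (x + t *\<^sub>R axis i 1))\<^sup>2)) has_real_derivative k' ((norm x)\<^sup>2) * (2 * x $ i)) (at 0)"
      using DERIV_chain2[OF k_deriv norm_square_along_axis[of x i]] by simp
    then have "((\<lambda>t. k ((norm (x + t *\<^sub>R axis i 1))\<^sup>2) * (x $ i + t)) has_real_derivative D i x) (at 0)"
      by (rule derivative_eq_intros refl)+
         (auto simp: D_def power2_eq_square intro!: derivative_eq_intros)
    then show ?thesis by (simp add: \<Phi>_i)
  qed
  then have "(LINT x|\<mu>. \<Phi> x $ i * partial_deriv i \<phi> x) = - (LINT x|\<mu>. D i x * \<phi> x)" for i
    by (rule integral_by_parts[OF \<phi> _ \<Phi>_i_cont D_cont])
  moreover have "integrable \<mu> (\<lambda>x. \<Phi> x $ i * partial_deriv i \<phi> x)"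
    "integrable \<mu> (\<lambda>x. D i x * \<phi> x)" for i
    by (intro L2_disk_mult_integrable L2_disk_continuous \<Phi>_i_cont D_cont
        test_function_partial_continuous test_function_continuous \<phi>)+
  moreover have "grad \<phi> x \<bullet> \<Phi> x = \<Phi> x $ 1 * partial_deriv 1 \<phi> x + \<Phi> x $ 2 * partial_deriv 2 \<phi> x" for x
    by (simp add: inner_vec_def sum_2 grad_def mult.commute)
  moreover have "\<phi> x * (2 * h' ((norm x)\<^sup>2)) = D 1 x * \<phi> x + D 2 x * \<phi> x" for x
  proof -
    have "(norm x)\<^sup>2 = (x $ 1)\<^sup>2 + (x $ 2)\<^sup>2"
      unfolding power2_norm_eq_inner by (simp add: inner_vec_def sum_2 power2_eq_square)
    then have "D 1 x + D 2 x = 2 * (k ((norm x)\<^sup>2) + (norm x)\<^sup>2 * k' ((norm x)\<^sup>2))"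
      by (simp add: D_def algebra_simps)
    \<comment> \<open>The left side is the derivative of \<open>s * k s\<close>, and
      \<open>s * k s = h s\<close> for every \<open>s\<close>.\<close>
    also have "k s + s * k' s = h' s" for s
      by (cases "s \<le> a") (use a in \<open>auto simp: k_def k'_def h_left power2_eq_square field_simps\<close>)
    finally show ?thesis by (metis distrib_right mult.commute)
  qed
  ultimately show ?thesis by simp
qed

end

section \<open>From test functions to \<open>H10\<close> by approximation\<close>

lemma is_weak_gradient_add_scaled:
  assumes u: "L2_disk u" "is_weak_gradient u G" and v: "L2_disk v" "is_weak_gradient v H"
  shows "is_weak_gradient (\<lambda>x. u x + c * v x) (\<lambda>x. G x + c *\<^sub>R H x)"
  unfolding is_weak_gradient_def
proof (intro conjI allI impI)
  have L: "L2_disk G" "L2_disk H" using u v by (auto simp: is_weak_gradient_def)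
  then show "L2_disk (\<lambda>x. G x + c *\<^sub>R H x)" by (intro L2_disk_add L2_disk_scaleR)
  fix \<phi> i assume \<phi>: "test_function \<phi>"
  have "integrable \<mu> (\<lambda>x. w x * partial_deriv i \<phi> x)" if "L2_disk w" for w
    by (intro L2_disk_mult_integrable that L2_disk_continuous test_function_partial_continuous \<phi>)
  moreover have "integrable \<mu> (\<lambda>x. F x $ i * \<phi> x)" if "L2_disk F" for F
    by (intro L2_disk_mult_integrable L2_disk_component that L2_disk_continuous test_function_continuous \<phi>)
  ultimately show "(LINT x|\<mu>. (u x + c * v x) * partial_deriv i \<phi> x) =
      - (LINT x|\<mu>. (G x + c *\<^sub>R H x) $ i * \<phi> x)"
    using u v L \<phi> unfolding is_weak_gradient_def
    by (simp add: distrib_right mult.assoc)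
qed

text \<open>The \<open>H1_norm\<close> of the difference dominates both distances, the second one by
  uniqueness of weak gradients.\<close>

lemma H10_approximation:
  assumes "u \<in> H10" and G: "is_weak_gradient u G"
  obtains \<phi> where "\<And>n::nat. test_function (\<phi> n)"
    "(\<lambda>n. L2_norm_disk (\<lambda>x. \<phi> n x - u x)) \<longlonglongrightarrow> 0"
    "(\<lambda>n. L2_norm_disk (\<lambda>x. grad (\<phi> n) x - G x)) \<longlonglongrightarrow> 0"
proof -
  obtain \<phi> where \<phi>: "\<And>n. test_function (\<phi> n)" and u: "L2_disk u"
    and lim: "(\<lambda>n. H1_norm (\<lambda>x. \<phi> n x - u x)) \<longlonglongrightarrow> 0"
    using assms(1) unfolding H10_def H1_def by blast
  have "is_weak_gradient (\<lambda>x. \<phi> n x - u x) (\<lambda>x. grad (\<phi> n) x - G x)" for n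
    using is_weak_gradient_add_scaled[OF L2_disk_continuous[OF test_function_continuous[OF \<phi>]]
        test_function_weak_gradient[OF \<phi>] u G, of n "-1"] by simp
  from H1_norm_eq[OF this]
  have "L2_norm_disk (\<lambda>x. \<phi> n x - u x) \<le> H1_norm (\<lambda>x. \<phi> n x - u x)"
    "L2_norm_disk (\<lambda>x. grad (\<phi> n) x - G x) \<le> H1_norm (\<lambda>x. \<phi> n x - u x)" for n
    by (auto intro: real_le_rsqrt)
  then have "(\<lambda>n. L2_norm_disk (\<lambda>x. \<phi> n x - u x)) \<longlonglongrightarrow> 0"
    "(\<lambda>n. L2_norm_disk (\<lambda>x. grad (\<phi> n) x - G x)) \<longlonglongrightarrow> 0"
    by (auto intro!: tendsto_sandwich[OF _ _ tendsto_const lim] simp: L2_norm_nonneg)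
  with \<phi> show thesis by (rule that)
qed

lemma L2_inner_tendsto:
  assumes "\<And>n. L2_disk (f n)" "L2_disk g" "L2_disk w"
    and lim: "(\<lambda>n. L2_norm_disk (\<lambda>x. f n x - g x)) \<longlonglongrightarrow> 0"
  shows "(\<lambda>n. LINT x|\<mu>. f n x \<bullet> w x) \<longlonglongrightarrow> (LINT x|\<mu>. g x \<bullet> w x)"
proof (rule Lim_null_comparison[THEN LIM_zero_cancel])
  have "norm ((LINT x|\<mu>. f n x \<bullet> w x) - (LINT x|\<mu>. g x \<bullet> w x)) \<le>
      L2_norm_disk (\<lambda>x. f n x - g x) * L2_norm_disk w" for n
    using L2_Cauchy_Schwarz[OF L2_disk_diff[OF assms(1)[of n] assms(2)] assms(3)] assms(1-3)
    by (simp add: inner_diff_left L2_disk_inner_integrable)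
  then show "eventually (\<lambda>n. norm ((LINT x|\<mu>. f n x \<bullet> w x) - (LINT x|\<mu>. g x \<bullet> w x)) \<le>
      L2_norm_disk (\<lambda>x. f n x - g x) * L2_norm_disk w) sequentially" by simp
  show "(\<lambda>n. L2_norm_disk (\<lambda>x. f n x - g x) * L2_norm_disk w) \<longlonglongrightarrow> 0"
    using tendsto_mult_right[OF lim] by simp
qed

text \<open>The zero boundary values of \<open>u\<close> enter here: \<open>\<Phi>\<close> need not
  vanish on the circle, but the approximating test functions do, so no boundary term survives the
  limit.\<close>

lemma (in radial_field) flux_H10:
  assumes u: "u \<in> H10" and G: "is_weak_gradient u G"
  shows "(LINT x|\<mu>. u x * (2 * h' ((norm x)\<^sup>2))) = - (LINT x|\<mu>. G x \<bullet> \<Phi> x)"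
proof -
  obtain \<phi> where \<phi>: "\<And>n::nat. test_function (\<phi> n)"
    and lim: "(\<lambda>n. L2_norm_disk (\<lambda>x. \<phi> n x - u x)) \<longlonglongrightarrow> 0"
    "(\<lambda>n. L2_norm_disk (\<lambda>x. grad (\<phi> n) x - G x)) \<longlonglongrightarrow> 0"
    using H10_approximation[OF assms] by blast
  have L: "L2_disk u" "L2_disk G"
    using assms by (auto simp: H10_def H1_def is_weak_gradient_def)
  have "continuous_on UNIV (\<lambda>x::real^2. 2 * h' ((norm x)\<^sup>2))"
    by (intro continuous_intros continuous_on_compose2[OF h'_cont]) auto
  then have "(\<lambda>n. LINT x|\<mu>. \<phi> n x * (2 * h' ((norm x)\<^sup>2))) \<longlonglongrightarrow> (LINT x|\<mu>. u x * (2 * h' ((norm x)\<^sup>2)))"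
    using L2_inner_tendsto[OF _ L(1) _ lim(1), of "\<lambda>x. 2 * h' ((norm x)\<^sup>2)"] \<phi>
    by (simp add: L2_disk_continuous test_function_continuous)
  moreover have "(\<lambda>n. - (LINT x|\<mu>. grad (\<phi> n) x \<bullet> \<Phi> x)) \<longlonglongrightarrow> - (LINT x|\<mu>. G x \<bullet> \<Phi> x)"
    by (intro tendsto_minus L2_inner_tendsto L lim L2_disk_continuous
        test_function_grad_continuous \<phi> \<Phi>_cont)
  ultimately show ?thesis
    using flux_test_function[OF \<phi>] by (simp add: LIMSEQ_unique)
qed

text \<open>In the variable \<open>s\<close>, the squared length of \<open>\<Phi>\<close> is
  \<open>s * (k s)\<^sup>2\<close>, which is at most \<open>1 / s\<close> on \<open>[a, 1]\<close>
  and 0 below \<open>a\<close>; integrating \<open>1 / s\<close> gives the logarithm.\<close>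

lemma (in radial_field) \<Phi>_norm_le:
  assumes "a < 1" "\<And>s. 0 \<le> h s" "\<And>s. h s \<le> 1"
  shows "L2_norm_disk \<Phi> \<le> sqrt (pi * ln (1 / a))"
proof -
  have meas: "(\<lambda>s. s * (k s)\<^sup>2) \<in> borel_measurable borel"
    by (intro borel_measurable_continuous_onI continuous_intros k_cont)
  have FTC: "has_bochner_integral lborel (\<lambda>s. 1 / s * indicator {a..1} s) (ln 1 - ln a)"
    using assms(1) a
    by (intro has_bochner_integral_FTC_Icc_real) (auto intro!: derivative_eq_intros continuous_intros)
  have le: "s * (k s)\<^sup>2 * indicator {0..1} s \<le> 1 / s * indicator {a..1} s" for s
  proof (cases "s \<in> {a..1}")
    case True
    have "(h s)\<^sup>2 \<le> 1" using assms by (simp add: power_le_one)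
    moreover have "max s a = s" "s > 0" using True a by auto
    ultimately show ?thesis
      using True by (simp add: k_def power_divide power2_eq_square divide_right_mono)
  next
    case False
    then show ?thesis using a by (auto simp: k_def h_left indicator_def)
  qed
  have "(L2_norm_disk \<Phi>)\<^sup>2 = (LINT x|\<mu>. (norm x)\<^sup>2 * (k ((norm x)\<^sup>2))\<^sup>2)"
    by (simp add: L2_norm_square \<Phi>_def power_mult_distrib mult.commute)
  also have "\<dots> = pi * (LINT s|lborel. s * (k s)\<^sup>2 * indicator {0..1} s)"
    by (rule integral_radial[OF meas])
  also have "\<dots> \<le> pi * (LINT s|lborel. 1 / s * indicator {a..1} s)"
  proof (intro mult_left_mono integral_mono)
    show 1: "integrable lborel (\<lambda>s. 1 / s * indicator {a..1} s)"
      using FTC by (simp add: has_bochner_integral_iff)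
    show "integrable lborel (\<lambda>s. s * (k s)\<^sup>2 * indicator {0..1} s)"
    proof (rule Bochner_Integration.integrable_bound[OF 1])
      show "(\<lambda>s. s * (k s)\<^sup>2 * indicator {0..1} s) \<in> borel_measurable lborel"
        using meas by measurable
      have "0 \<le> s * (k s)\<^sup>2 * indicator {0..1} s" for s
        by (auto simp: indicator_def)
      then have "norm (s * (k s)\<^sup>2 * indicator {0..1} s) \<le> norm (1 / s * indicator {a..1} s)" for s
        using le[of s] order_trans[OF _ le, of 0 s] unfolding real_norm_def by (simp only: abs_of_nonneg)
      then show "AE s in lborel. norm (s * (k s)\<^sup>2 * indicator {0..1} s) \<le> norm (1 / s * indicator {a..1} s)"
        by (intro AE_I2)
    qed
  qed (use le in auto)
  also have "\<dots> = pi * ln (1 / a)"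
    using FTC a by (simp add: has_bochner_integral_iff ln_div)
  finally show ?thesis by (rule real_le_rsqrt)
qed

text \<open>Finiteness is all that is wanted, so the factor 2 is affordable: it is the price of
  replacing \<open>u\<close> near radius \<open>r\<close> by half its value at
  \<open>r\<close>.\<close>

lemma H10_rad_profile_bound:
  assumes u: "u \<in> H10_rad" and r: "0 < r" "r < 1"
  shows "\<bar>radial_profile u r\<bar> / sqrt (1 / (2 * pi) * ln (1 / r)) \<le> 2 * H10_norm u"
proof (cases "radial_profile u r = 0")
  case True
  then show ?thesis by (simp add: H10_norm_def L2_norm_nonneg)
next
  case False
  let ?e = "axis 1 1 :: real^2"
  define G where "G = weak_gradient u"
  define \<sigma> m where "\<sigma> = sgn (radial_profile u r)" and "m = \<bar>radial_profile u r\<bar> / 2"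
  have m: "m > 0" "\<sigma> * radial_profile u r = 2 * m" "\<bar>\<sigma>\<bar> = 1"
    using False by (auto simp: m_def \<sigma>_def sgn_if)
  have u': "u \<in> H10" "continuous_on (disk - {0}) u"
    and rad: "\<And>x y. x \<in> disk - {0} \<Longrightarrow> y \<in> disk - {0} \<Longrightarrow> norm x = norm y \<Longrightarrow> u x = u y"
    using u unfolding H10_rad_def by blast+
  have G: "is_weak_gradient u G"
    using u'(1) weak_gradient_works unfolding G_def H10_def H1_def by blast
  have "continuous_on {0<..<1} (radial_profile u)"
    unfolding radial_profile_def
    by (rule continuous_on_compose2[OF u'(2)]) (auto intro!: continuous_intros)
  then have "isCont (radial_profile u) r"
    using r by (simp add: continuous_on_eq_continuous_at)
  then have "isCont (\<lambda>t. \<sigma> * radial_profile u t) r"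
    by (intro continuous_intros)
  then obtain d where d: "d > 0" "\<And>t. \<bar>t - r\<bar> < d \<Longrightarrow> \<bar>\<sigma> * radial_profile u t - 2 * m\<bar> < m"
    using m unfolding continuous_at_eps_delta dist_real_def by metis
  \<comment> \<open>The annulus from \<open>r\<close> to \<open>\<rho>\<close> stays within the
    continuity radius \<open>d\<close> and inside the disk. It lies on the outer side of
    \<open>r\<close>, so that \<open>h\<close> vanishes up to \<open>r\<^sup>2\<close> and
    \<open>\<Phi>_norm_le\<close> applies with \<open>a = r\<^sup>2\<close>.\<close>
  define \<rho> where "\<rho> = min (r + d / 2) ((1 + r) / 2)"
  have \<rho>: "r < \<rho>" "\<rho> < 1" "\<rho> < r + d" using r d by (auto simp: \<rho>_def min_def)
  have "r\<^sup>2 < \<rho>\<^sup>2" using r \<rho> by (intro power_strict_mono) auto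
  then obtain h h' where h: "\<And>s. (h has_real_derivative h' s) (at s)" "continuous_on UNIV h'"
    "\<And>s. 0 \<le> h' s" "\<And>s. s \<notin> {r\<^sup>2<..<\<rho>\<^sup>2} \<Longrightarrow> h' s = 0"
    "\<And>s. s \<le> r\<^sup>2 \<Longrightarrow> h s = 0" "\<And>s. s \<ge> \<rho>\<^sup>2 \<Longrightarrow> h s = 1" "\<And>s. 0 \<le> h s" "\<And>s. h s \<le> 1"
    using C1_step_function by metis
  interpret radial_field "r\<^sup>2" h h'
    by unfold_locales (use r h in auto)
  have cont: "continuous_on UNIV (\<lambda>x::real^2. 2 * h' ((norm x)\<^sup>2))"
    by (intro continuous_intros continuous_on_compose2[OF h(2)]) auto
  have ge: "m * (2 * h' ((norm x)\<^sup>2)) \<le> \<sigma> * (u x * (2 * h' ((norm x)\<^sup>2)))" for x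
  proof (cases "(norm x)\<^sup>2 \<in> {r\<^sup>2<..<\<rho>\<^sup>2}")
    case True
    then have n: "r < norm x" "norm x < \<rho>"
      using r \<rho> by (auto dest: power2_less_imp_less)
    have "norm (norm x *\<^sub>R ?e) = norm x" by (simp add: norm_axis_1)
    then have "u x = radial_profile u (norm x)"
      unfolding radial_profile_def using n r \<rho> by (intro rad) auto
    then have "m \<le> \<sigma> * u x"
      using d(2)[of "norm x"] n \<rho> by (simp add: abs_less_iff)
    then have "m * (2 * h' ((norm x)\<^sup>2)) \<le> (\<sigma> * u x) * (2 * h' ((norm x)\<^sup>2))"
      using h(3) by (intro mult_right_mono) auto
    then show ?thesis by (simp add: mult.assoc)
  next
    case False
    then show ?thesis by (simp add: h(4))
  qed
  \<comment> \<open>The weight has total mass \<open>2 * pi\<close>, because \<open>h\<close> climbs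
    from 0 to 1 inside the unit interval.\<close>
  have "2 * pi * m = m * (LINT x|\<mu>. 2 * h' ((norm x)\<^sup>2))"
  proof -
    have "(LINT s|lborel. (2 * h' s) * indicator {0..1} s) = 2 * h 1 - 2 * h 0"
    proof (rule integral_FTC_Icc_real)
      show "((\<lambda>s. 2 * h s) has_real_derivative 2 * h' s) (at s)" for s
        by (rule derivative_eq_intros h(1) refl)+ simp
      show "isCont (\<lambda>s. 2 * h' s) s" for s
        using h(2) by (auto simp: continuous_on_eq_continuous_at intro!: continuous_intros)
    qed simp
    moreover have "h 1 = 1" "h 0 = 0" using r \<rho> by (auto intro!: h power_le_one)
    moreover have "(\<lambda>s. 2 * h' s) \<in> borel_measurable borel"
      using h(2) by (intro borel_measurable_continuous_onI continuous_intros)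
    ultimately show ?thesis
      using integral_radial[of "\<lambda>s. 2 * h' s"] by simp
  qed
  also have "\<dots> = (LINT x|\<mu>. m * (2 * h' ((norm x)\<^sup>2)))" by simp
  also have "\<dots> \<le> (LINT x|\<mu>. \<sigma> * (u x * (2 * h' ((norm x)\<^sup>2))))"
  proof (rule integral_mono)
    show "integrable \<mu> (\<lambda>x. m * (2 * h' ((norm x)\<^sup>2)))"
      using L2_disk_mult_integrable[OF L2_disk_continuous[OF continuous_on_const] L2_disk_continuous[OF cont]] .
    have "L2_disk u" using u' by (simp add: H10_def H1_def)
    then show "integrable \<mu> (\<lambda>x. \<sigma> * (u x * (2 * h' ((norm x)\<^sup>2))))"
      by (intro integrable_mult_right L2_disk_mult_integrable L2_disk_continuous[OF cont])
  qed (rule ge)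
  also have "\<dots> = - \<sigma> * (LINT x|\<mu>. G x \<bullet> \<Phi> x)"
    unfolding integral_mult_right_zero flux_H10[OF u'(1) G] by simp
  also have "\<dots> \<le> \<bar>LINT x|\<mu>. G x \<bullet> \<Phi> x\<bar>"
    using abs_ge_self[of "- \<sigma> * (LINT x|\<mu>. G x \<bullet> \<Phi> x)"] m(3)
    unfolding abs_mult abs_minus_cancel by simp
  also have "\<dots> \<le> L2_norm_disk G * L2_norm_disk \<Phi>"
    using G by (intro L2_Cauchy_Schwarz L2_disk_continuous[OF \<Phi>_cont]) (simp add: is_weak_gradient_def)
  also have "\<dots> \<le> H10_norm u * sqrt (pi * ln (1 / r\<^sup>2))"
    unfolding H10_norm_def G_def using r h
    by (intro mult_left_mono \<Phi>_norm_le) (auto simp: power_less_one_iff L2_norm_nonneg)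
  also have "ln (1 / r\<^sup>2) = 2 * ln (1 / r)"
    using r by (simp add: ln_div ln_realpow)
  \<comment> \<open>Extracts the factor \<open>2 * pi\<close> that cancels the mass of the weight
    and leaves the denominator of \<open>norm_2star\<close>.\<close>
  also have "sqrt (pi * (2 * ln (1 / r))) = 2 * pi * sqrt (1 / (2 * pi) * ln (1 / r))"
    by (rule real_sqrt_unique) (use r in \<open>auto simp: power_mult_distrib power2_eq_square field_simps ln_div\<close>)
  finally have "m \<le> H10_norm u * sqrt (1 / (2 * pi) * ln (1 / r))"
    by (simp add: field_simps)
  moreover have "sqrt (1 / (2 * pi) * ln (1 / r)) > 0"
    using r by (intro real_sqrt_gt_zero mult_pos_pos ln_gt_zero) auto
  ultimately show ?thesis
    unfolding m_def by (subst pos_divide_le_eq) auto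
qed

section \<open>Bumps at the boundary\<close>

lemma is_weak_gradient_zero: "is_weak_gradient (\<lambda>x. 0) (\<lambda>x. 0)"
  by (simp add: is_weak_gradient_def L2_disk_continuous)

lemma H1_norm_zero: "H1_norm (\<lambda>x. 0) = 0"
  using H1_norm_eq[OF is_weak_gradient_zero] by (simp add: L2_norm_disk_def)

lemma test_function_H10: assumes "test_function \<phi>" shows "\<phi> \<in> H10"
  unfolding H10_def H1_def
proof (intro CollectI conjI exI)
  show "L2_disk \<phi>" by (intro L2_disk_continuous test_function_continuous assms)
  show "is_weak_gradient \<phi> (grad \<phi>)" by (rule test_function_weak_gradient[OF assms])
  show "\<forall>k. test_function ((\<lambda>k. \<phi>) k)" using assms by simp
  show "(\<lambda>k. H1_norm (\<lambda>x. \<phi> x - \<phi> x)) \<longlonglongrightarrow> 0" by (simp add: H1_norm_zero)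
qed

text \<open>The approximants of a general \<open>u\<close> are arbitrary test functions, not
  \<open>smooth_expr\<close> terms, so sums are handled at the level of \<open>C_k\<close>.\<close>

lemma C_k_add_scaled:
  "C_k k f \<Longrightarrow> C_k k g \<Longrightarrow> C_k k (\<lambda>x. f x + c * g x)"
proof (induction k arbitrary: f g)
  case 0
  then show ?case by (auto intro!: continuous_intros)
next
  case (Suc k)
  have D: "((\<lambda>x. f x + c * g x) has_derivative
      (\<lambda>h. frechet_derivative f (at x) h + c * frechet_derivative g (at x) h)) (at x)" for x
    using Suc.prems by (intro has_derivative_add has_derivative_mult_right) (auto simp: frechet_derivative_works)
  have "partial_deriv i (\<lambda>x. f x + c * g x) = (\<lambda>x. partial_deriv i f x + c * partial_deriv i g x)" for i
    by (rule ext, subst partial_deriv_eqI[OF D]) (simp add: partial_deriv_def)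
  then show ?case
    using D Suc by (auto intro: differentiableI)
qed

lemma test_function_add_scaled:
  assumes "test_function f" "test_function g"
  shows "test_function (\<lambda>x. f x + c * g x)"
proof -
  let ?S = "\<lambda>f. closure {x::real^2. f x \<noteq> (0::real)}"
  have sub: "?S (\<lambda>x. f x + c * g x) \<subseteq> ?S f \<union> ?S g"
    unfolding closure_Un[symmetric] by (intro closure_mono) auto
  have S: "compact (?S f \<union> ?S g)" "?S f \<union> ?S g \<subseteq> disk"
    using assms by (auto simp: test_function_def)
  have "compact (?S (\<lambda>x. f x + c * g x))"
    using compact_Int_closed[OF S(1) closed_closure, of "{x. f x + c * g x \<noteq> 0}"]
    unfolding Int_absorb1[OF sub] .
  with sub S(2) show ?thesis
    using assms unfolding test_function_def by (blast intro: C_k_add_scaled)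
qed

definition radial_test :: "(real^2 \<Rightarrow> real) \<Rightarrow> bool" where
  "radial_test f \<longleftrightarrow> test_function f \<and> (\<forall>x y. norm x = norm y \<longrightarrow> f x = f y)"

lemma radial_testD:
  assumes "radial_test f"
  shows "test_function f" "norm x = norm y \<Longrightarrow> f x = f y"
  using assms unfolding radial_test_def by blast+

lemma radial_test_zero: "radial_test (\<lambda>x. 0)"
  by (auto simp: radial_test_def intro!: test_functionI[of _ 0] smooth_expr.const)

lemma radial_test_add_scaled:
  assumes f: "radial_test f" and g: "radial_test g"
  shows "radial_test (\<lambda>x. f x + c * g x)"
  unfolding radial_test_def
proof (intro conjI allI impI)
  show "test_function (\<lambda>x. f x + c * g x)"
    by (intro test_function_add_scaled f g radial_testD(1))
  fix x y :: "real^2" assume n: "norm x = norm y"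
  have "f x = f y" "g x = g y"
    by (rule radial_testD(2)[OF f n] radial_testD(2)[OF g n])+
  then show "f x + c * g x = f y + c * g y" by simp
qed

lemma radial_test_H10_rad: "radial_test f \<Longrightarrow> f \<in> H10_rad"
  unfolding radial_test_def H10_rad_def
  using test_function_H10 test_function_continuous continuous_on_subset by blast

text \<open>Shifting the approximants of \<open>u\<close> by the same \<open>c * w\<close> leaves
  the differences, hence the convergence, unchanged.\<close>

lemma H10_rad_add_test:
  assumes u: "u \<in> H10_rad" and w: "radial_test w"
  shows "(\<lambda>x. u x + c * w x) \<in> H10_rad"
proof -
  have u': "L2_disk u" "continuous_on (disk - {0}) u"
    "\<And>x y. x \<in> disk - {0} \<Longrightarrow> y \<in> disk - {0} \<Longrightarrow> norm x = norm y \<Longrightarrow> u x = u y"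
    using u unfolding H10_rad_def H10_def H1_def by blast+
  obtain \<phi> G where \<phi>: "\<And>k::nat. test_function (\<phi> k)" "(\<lambda>k. H1_norm (\<lambda>x. \<phi> k x - u x)) \<longlonglongrightarrow> 0"
    and G: "is_weak_gradient u G"
    using u unfolding H10_rad_def H10_def H1_def by blast
  have w': "test_function w" "\<And>x y. norm x = norm y \<Longrightarrow> w x = w y"
    using radial_testD[OF w] by blast+
  have wc: "continuous_on UNIV w" by (rule test_function_continuous[OF w'(1)])
  show ?thesis
    unfolding H10_rad_def H10_def H1_def
  proof (intro CollectI conjI exI ballI impI)
    show "L2_disk (\<lambda>x. u x + c * w x)"
      using L2_disk_add[OF u'(1) L2_disk_scaleR[OF L2_disk_continuous[OF wc]], of c] by simp
    show "is_weak_gradient (\<lambda>x. u x + c * w x) (\<lambda>x. G x + c *\<^sub>R grad w x)"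
      by (intro is_weak_gradient_add_scaled u' G L2_disk_continuous wc test_function_weak_gradient w')
    show "\<forall>k. test_function ((\<lambda>k x. \<phi> k x + c * w x) k)"
      by (intro allI test_function_add_scaled \<phi> w')
    show "(\<lambda>k. H1_norm (\<lambda>x. (\<phi> k x + c * w x) - (u x + c * w x))) \<longlonglongrightarrow> 0"
      using \<phi>(2) by simp
    show "continuous_on (disk - {0}) (\<lambda>x. u x + c * w x)"
      by (intro continuous_intros u' continuous_on_subset[OF wc]) auto
    show "u x + c * w x = u y + c * w y"
      if "x \<in> disk - {0}" "y \<in> disk - {0}" "norm x = norm y" for x y
      using u'(3)[OF that] w'(2)[OF that(3)] by simp
  qed
qed

text \<open>Bumps of height \<open>sqrt \<delta>\<close> living on the annulus \<open>\<delta> < 1 - |x|\<^sup>2 < 2 \<delta>\<close>: this scaling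
  bounds the Dirichlet norm from above and the quotient in \<open>norm_2star\<close> from below.\<close>

definition \<eta> :: "real \<Rightarrow> real" where "\<eta> s = flat 0 (s - 1) * flat 0 (2 - s)"
definition \<eta>' :: "real \<Rightarrow> real" where "\<eta>' s = flat 2 (s - 1) * flat 0 (2 - s) - flat 0 (s - 1) * flat 2 (2 - s)"

definition bump :: "real \<Rightarrow> real^2 \<Rightarrow> real" where
  "bump \<delta> x = sqrt \<delta> * \<eta> (inverse \<delta> * (1 - (norm x)\<^sup>2))"

lemma \<eta>_deriv: "(\<eta> has_real_derivative \<eta>' s) (at s)"
proof -
  have f: "(flat 0 has_real_derivative flat 2 s) (at s)" for s
    using flat_derivative[of 0 s] by (simp add: numeral_2_eq_2)
  have "((\<lambda>s. s - 1) has_real_derivative 1) (at s)" "((\<lambda>s. 2 - s) has_real_derivative - 1) (at s)"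
    by (auto intro!: derivative_eq_intros)
  then have 1: "((\<lambda>s. flat 0 (s - 1)) has_real_derivative flat 2 (s - 1)) (at s)"
    and 2: "((\<lambda>s. flat 0 (2 - s)) has_real_derivative - flat 2 (2 - s)) (at s)"
    by (auto dest: DERIV_chain2[OF f])
  show ?thesis
    using DERIV_mult[OF 1 2] by (simp add: \<eta>_def[abs_def] \<eta>'_def algebra_simps)
qed

lemma \<eta>_support: "\<eta> s \<noteq> 0 \<Longrightarrow> 1 < s" "s \<notin> {1<..<2} \<Longrightarrow> \<eta>' s = 0"
  by (auto simp: \<eta>_def \<eta>'_def flat_def split: if_splits)

lemma \<eta>'_cont: "continuous_on UNIV \<eta>'"
  unfolding \<eta>'_def by (intro continuous_intros continuous_on_compose2[OF flat_continuous]) auto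

lemma \<eta>'_bounded: obtains M where "\<And>s. \<bar>\<eta>' s\<bar> \<le> M"
proof -
  have "compact (\<eta>' ` {1..2})"
    by (intro compact_continuous_image continuous_on_subset[OF \<eta>'_cont]) auto
  then obtain M where M: "\<And>s. s \<in> {1..2} \<Longrightarrow> norm (\<eta>' s) \<le> M"
    by (meson bounded_iff compact_imp_bounded image_eqI)
  have "0 \<le> M" using order_trans[OF norm_ge_zero M[of 1]] by simp
  then have "\<bar>\<eta>' s\<bar> \<le> M" for s
    using M[of s] \<eta>_support(2)[of s] by (cases "s \<in> {1..2}") auto
  then show thesis by (rule that)
qed

lemma bump_radial_test:
  assumes "0 < \<delta>" shows "radial_test (bump \<delta>)"
  unfolding radial_test_def
proof
  have "smooth_expr (\<lambda>x. sqrt \<delta> * (flat 0 (inverse \<delta> * (1 - (norm x)\<^sup>2) - 1) *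
      flat 0 (2 - inverse \<delta> * (1 - (norm x)\<^sup>2))))"
    by (intro smooth_expr.intros smooth_expr_diff smooth_expr_norm_square)
  then have "smooth_expr (bump \<delta>)"
    by (simp add: bump_def[abs_def] \<eta>_def)
  then show "test_function (bump \<delta>)"
  proof (rule test_functionI)
    show "norm x \<le> sqrt (1 - \<delta>)" if "bump \<delta> x \<noteq> 0" for x
    proof (rule real_le_rsqrt)
      have "1 < inverse \<delta> * (1 - (norm x)\<^sup>2)"
        using that by (intro \<eta>_support) (simp add: bump_def)
      then show "(norm x)\<^sup>2 \<le> 1 - \<delta>" using assms by (simp add: field_simps)
    qed
  qed (use assms in simp)
qed (simp add: bump_def)

lemma grad_bump:
  assumes "0 < \<delta>"
  shows "grad (bump \<delta>) x = - (2 / sqrt \<delta> * \<eta>' (inverse \<delta> * (1 - (norm x)\<^sup>2))) *\<^sub>R x"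
proof -
  have "partial_deriv i (bump \<delta>) x = - (2 / sqrt \<delta> * \<eta>' (inverse \<delta> * (1 - (norm x)\<^sup>2))) * x $ i" for i
  proof (rule DERIV_unique)
    show "((\<lambda>t. bump \<delta> (x + t *\<^sub>R axis i 1)) has_real_derivative partial_deriv i (bump \<delta>) x) (at 0)"
      using bump_radial_test[OF assms]
      by (intro partial_deriv_along_axis test_function_differentiable radial_testD(1))
    have "((\<lambda>t. inverse \<delta> * (1 - (norm (x + t *\<^sub>R axis i 1))\<^sup>2)) has_real_derivative
        inverse \<delta> * (0 - 2 * x $ i)) (at 0)"
      by (intro DERIV_cmult DERIV_diff DERIV_const norm_square_along_axis)
    from DERIV_cmult[OF DERIV_chain2[OF \<eta>_deriv this], of "sqrt \<delta>"]
    have "((\<lambda>t. bump \<delta> (x + t *\<^sub>R axis i 1)) has_real_derivative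
        sqrt \<delta> * (\<eta>' (inverse \<delta> * (1 - (norm x)\<^sup>2)) * (inverse \<delta> * (0 - 2 * x $ i)))) (at 0)"
      by (simp add: bump_def)
    moreover have "sqrt \<delta> * inverse \<delta> = 1 / sqrt \<delta>"
      using assms by (simp add: field_simps)
    then have "sqrt \<delta> * (\<eta>' z * (inverse \<delta> * (0 - 2 * x $ i))) = - (2 / sqrt \<delta> * \<eta>' z) * x $ i" for z
      by (metis (no_types, opaque_lifting) diff_0 mult.assoc mult.commute mult_minus_right
          mult_minus_left times_divide_eq_left mult_1 divide_inverse)
    ultimately show "((\<lambda>t. bump \<delta> (x + t *\<^sub>R axis i 1)) has_real_derivative
        - (2 / sqrt \<delta> * \<eta>' (inverse \<delta> * (1 - (norm x)\<^sup>2))) * x $ i) (at 0)"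
      by simp
  qed
  then show ?thesis by (simp add: grad_def vec_eq_iff)
qed

lemma grad_bump_support:
  assumes "0 < \<delta>" "grad (bump \<delta>) x \<noteq> 0"
  shows "\<delta> < 1 - (norm x)\<^sup>2" "1 - (norm x)\<^sup>2 < 2 * \<delta>"
proof -
  have "inverse \<delta> * (1 - (norm x)\<^sup>2) \<in> {1<..<2}"
    using assms grad_bump[OF assms(1), of x] \<eta>_support(2) by fastforce
  then show "\<delta> < 1 - (norm x)\<^sup>2" "1 - (norm x)\<^sup>2 < 2 * \<delta>"
    using assms(1) by (auto simp: field_simps)
qed

text \<open>The squared gradient is at most \<open>4 * M\<^sup>2 / \<delta>\<close>, and in the
  variable \<open>s\<close> it lives on an interval of length \<open>\<delta>\<close>, so
  \<open>\<delta>\<close> cancels.\<close>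

lemma bump_energy_bounded:
  obtains K where "\<And>\<delta>. 0 < \<delta> \<Longrightarrow> (L2_norm_disk (grad (bump \<delta>)))\<^sup>2 \<le> K"
proof -
  obtain M where M: "\<And>s. \<bar>\<eta>' s\<bar> \<le> M" using \<eta>'_bounded by blast
  have "(L2_norm_disk (grad (bump \<delta>)))\<^sup>2 \<le> pi * (4 * M\<^sup>2)" if "0 < \<delta>" for \<delta>
  proof -
    define f where "f s = 4 / \<delta> * (\<eta>' (inverse \<delta> * (1 - s)))\<^sup>2 * s" for s
    have meas: "f \<in> borel_measurable borel"
      unfolding f_def
      by (intro borel_measurable_continuous_onI continuous_intros continuous_on_compose2[OF \<eta>'_cont]) auto
    have g: "integrable lborel (\<lambda>s. 4 / \<delta> * M\<^sup>2 * indicator {1 - 2 * \<delta>..1 - \<delta>} s)"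
      by (intro integrable_mult_right) (auto simp: emeasure_bounded_finite[simplified])
    have le: "f s * indicator {0..1} s \<le> 4 / \<delta> * M\<^sup>2 * indicator {1 - 2 * \<delta>..1 - \<delta>} s" for s
    proof (cases "s \<in> {0..1} \<and> s \<in> {1 - 2 * \<delta>..1 - \<delta>}")
      case True
      have "(\<eta>' (inverse \<delta> * (1 - s)))\<^sup>2 * s \<le> M\<^sup>2 * 1"
        using True M[of "inverse \<delta> * (1 - s)"] abs_le_square_iff[of "\<eta>' (inverse \<delta> * (1 - s))" M]
        by (intro mult_mono) auto
      then show ?thesis
        using True that by (simp add: f_def divide_right_mono)
    next
      case False
      have "f s = 0" if "s \<notin> {1 - 2 * \<delta>..1 - \<delta>}"
      proof -
        have "inverse \<delta> * (1 - s) \<notin> {1<..<2}" using that \<open>0 < \<delta>\<close> by (auto simp: field_simps)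
        then show ?thesis by (simp add: f_def \<eta>_support)
      qed
      then show ?thesis using False that by (auto simp: indicator_def)
    qed
    have "(L2_norm_disk (grad (bump \<delta>)))\<^sup>2 = (LINT x|\<mu>. f ((norm x)\<^sup>2))"
      using that by (simp add: L2_norm_square grad_bump f_def power_mult_distrib power_divide)
    also have "\<dots> = pi * (LINT s|lborel. f s * indicator {0..1} s)"
      by (rule integral_radial[OF meas])
    also have "\<dots> \<le> pi * (LINT s|lborel. 4 / \<delta> * M\<^sup>2 * indicator {1 - 2 * \<delta>..1 - \<delta>} s)"
    proof (intro mult_left_mono integral_mono g le)
      show "integrable lborel (\<lambda>s. f s * indicator {0..1} s)"
      proof (rule Bochner_Integration.integrable_bound[OF g])
        show "(\<lambda>s. f s * indicator {0..1} s) \<in> borel_measurable lborel"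
          using meas by measurable
        have "0 \<le> f s * indicator {0..1} s" for s
          using that by (auto simp: f_def indicator_def)
        then have "norm (f s * indicator {0..1} s) \<le> norm (4 / \<delta> * M\<^sup>2 * indicator {1 - 2 * \<delta>..1 - \<delta>} s)" for s
          using le[of s] order_trans[OF _ le, of 0 s] unfolding real_norm_def by (simp only: abs_of_nonneg)
        then show "AE s in lborel. norm (f s * indicator {0..1} s) \<le> norm (4 / \<delta> * M\<^sup>2 * indicator {1 - 2 * \<delta>..1 - \<delta>} s)"
          by (intro AE_I2)
      qed
    qed simp
    also have "\<dots> = pi * (4 * M\<^sup>2)"
      using that by simp
    finally show ?thesis .
  qed
  then show thesis by (rule that)
qed

text \<open>At each point at most one of the gradients is nonzero, so Pythagoras holds pointwise.
  The exponent \<open>k + 2\<close> also keeps the parameters at most 1/4, as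
  \<open>bump_ratio\<close> demands.\<close>

lemma bump_combination_energy:
  assumes K: "\<And>\<delta>. 0 < \<delta> \<Longrightarrow> (L2_norm_disk (grad (bump \<delta>)))\<^sup>2 \<le> K"
  defines "e \<equiv> \<lambda>k::nat. bump ((1/2) ^ (k + 2))"
  shows "radial_test (\<lambda>x. \<Sum>k<n. c k * e k x)"
    "(H10_norm (\<lambda>x. \<Sum>k<n. c k * e k x))\<^sup>2 \<le> K * (\<Sum>k<n. (c k)\<^sup>2)"
proof -
  have e: "radial_test (e k)" for k
    unfolding e_def by (intro bump_radial_test) simp
  have test: "radial_test (\<lambda>x. \<Sum>k<n. c k * e k x)" for n
    by (induction n) (auto intro: radial_test_zero radial_test_add_scaled[OF _ e])
  then show "radial_test (\<lambda>x. \<Sum>k<n. c k * e k x)" .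
  have t: "test_function (e k)" for k by (intro radial_testD(1) e)
  have G: "is_weak_gradient (\<lambda>x. \<Sum>k<n. c k * e k x) (\<lambda>x. \<Sum>k<n. c k *\<^sub>R grad (e k) x)"
  proof (induction n)
    case (Suc n)
    then show ?case
      using is_weak_gradient_add_scaled[OF
          L2_disk_continuous[OF test_function_continuous[OF radial_testD(1)[OF test]]] Suc.IH
          L2_disk_continuous[OF test_function_continuous[OF t]] test_function_weak_gradient[OF t], of "c n" n]
      by simp
  qed (simp add: is_weak_gradient_zero)
  have disj: "grad (e j) x = 0 \<or> grad (e k) x = 0" if "j < k" for j k x
  proof (rule ccontr)
    assume "\<not> ?thesis"
    then have "(1/2) ^ (j + 2) < 1 - (norm x)\<^sup>2" "1 - (norm x)\<^sup>2 < 2 * (1/2) ^ (k + 2)"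
      using grad_bump_support[of "(1/2) ^ (j + 2)" x] grad_bump_support[of "(1/2) ^ (k + 2)" x]
      by (auto simp: e_def)
    \<comment> \<open>Dyadic parameters make the annuli adjacent: the upper end of one is at most
      the lower end of every earlier one.\<close>
    moreover have "2 * (1/2) ^ (k + 2) = (1/2 :: real) ^ (k + 1)" by simp
    moreover have "(1/2 :: real) ^ (k + 1) \<le> (1/2) ^ (j + 2)"
      using that by (intro power_decreasing) auto
    ultimately show False by linarith
  qed
  have "(norm (\<Sum>k<n. c k *\<^sub>R grad (e k) x))\<^sup>2 = (\<Sum>k<n. (norm (c k *\<^sub>R grad (e k) x))\<^sup>2)" for x
  proof (rule norm_sum_Pythagorean)
    show "pairwise (\<lambda>i j. orthogonal (c i *\<^sub>R grad (e i) x) (c j *\<^sub>R grad (e j) x)) {..<n}"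
      unfolding pairwise_def using disj by (metis linorder_neqE_nat orthogonal_clauses(1,6) scaleR_zero_right)
  qed simp
  then have "(H10_norm (\<lambda>x. \<Sum>k<n. c k * e k x))\<^sup>2 = (LINT x|\<mu>. (\<Sum>k<n. (c k)\<^sup>2 * (norm (grad (e k) x))\<^sup>2))"
    by (simp add: H10_norm_eq[OF G] L2_norm_square power_mult_distrib)
  also have "\<dots> = (\<Sum>k<n. (c k)\<^sup>2 * (L2_norm_disk (grad (e k)))\<^sup>2)"
    unfolding L2_norm_square
    by (subst Bochner_Integration.integral_sum)
       (auto intro!: L2_disk_integrable L2_disk_continuous test_function_grad_continuous t)
  also have "\<dots> \<le> (\<Sum>k<n. (c k)\<^sup>2 * K)"
    by (intro sum_mono mult_left_mono) (auto simp: e_def intro: K)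
  also have "\<dots> = K * (\<Sum>k<n. (c k)\<^sup>2)"
    by (simp add: sum_distrib_left mult.commute)
  finally show "(H10_norm (\<lambda>x. \<Sum>k<n. c k * e k x))\<^sup>2 \<le> K * (\<Sum>k<n. (c k)\<^sup>2)" .
qed

section \<open>Bounded functionals along the bumps\<close>

lemma H10_rad_functionalD:
  assumes "H10_rad_functional L"
  shows "u \<in> H10_rad \<Longrightarrow> v \<in> H10_rad \<Longrightarrow> L (\<lambda>x. u x + v x) = L u + L v"
    and "u \<in> H10_rad \<Longrightarrow> L (\<lambda>x. c * u x) = c * L u"
  using assms unfolding H10_rad_functional_def by blast+

text \<open>Bessel's inequality: testing \<open>L\<close> on \<open>\<Sum>k<n. L (e k) e k\<close> bounds \<open>\<Sum>k<n. (L (e k))\<^sup>2\<close>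
  uniformly in \<open>n\<close>.\<close>

lemma functional_bump_tendsto_zero:
  assumes L: "H10_rad_functional L"
  shows "(\<lambda>k. L (bump ((1/2) ^ (k + 2)))) \<longlonglongrightarrow> 0"
proof -
  define e where "e k = bump ((1/2) ^ (k + 2))" for k :: nat
  obtain K where K: "\<And>\<delta>. 0 < \<delta> \<Longrightarrow> (L2_norm_disk (grad (bump \<delta>)))\<^sup>2 \<le> K"
    using bump_energy_bounded by blast
  note add = H10_rad_functionalD(1)[OF L] and scale = H10_rad_functionalD(2)[OF L]
  obtain C where C: "\<And>u. u \<in> H10_rad \<Longrightarrow> \<bar>L u\<bar> \<le> C * H10_norm u"
    using L unfolding H10_rad_functional_def by blast
  have e: "radial_test (e k)" for k
    unfolding e_def by (intro bump_radial_test) simp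
  define v where "v n x = (\<Sum>k<n. L (e k) * e k x)" for n x
  have v: "radial_test (v n)" "(H10_norm (v n))\<^sup>2 \<le> K * (\<Sum>k<n. (L (e k))\<^sup>2)" for n
    using bump_combination_energy[OF K, of "\<lambda>k. L (e k)" n] by (auto simp: v_def[abs_def] e_def)
  have Lv: "L (v n) = (\<Sum>k<n. (L (e k))\<^sup>2)" for n
  proof (induction n)
    case 0
    show ?case
      using scale[OF radial_test_H10_rad[OF radial_test_zero], of 0] by (simp add: v_def[abs_def])
  next
    case (Suc n)
    have "(\<lambda>x. L (e n) * e n x) \<in> H10_rad"
      using radial_test_add_scaled[OF radial_test_zero e] by (simp add: radial_test_H10_rad)
    with radial_test_H10_rad[OF v(1)]
    have "L (\<lambda>x. v n x + L (e n) * e n x) = L (v n) + L (\<lambda>x. L (e n) * e n x)"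
      by (rule add)
    also have "(\<lambda>x. v n x + L (e n) * e n x) = v (Suc n)"
      by (simp add: v_def[abs_def])
    finally show ?case
      using Suc scale[OF radial_test_H10_rad[OF e]] by (simp add: power2_eq_square)
  qed
  have bound: "(\<Sum>k<n. (L (e k))\<^sup>2) \<le> C\<^sup>2 * K" for n
  proof -
    let ?S = "\<Sum>k<n. (L (e k))\<^sup>2"
    have "?S\<^sup>2 \<le> (C * H10_norm (v n))\<^sup>2"
      using C[OF radial_test_H10_rad[OF v(1)]] abs_le_square_iff[of ?S "C * H10_norm (v n)"]
      unfolding Lv by (metis abs_ge_self order_trans)
    also have "\<dots> \<le> C\<^sup>2 * (K * ?S)"
      unfolding power_mult_distrib by (intro mult_left_mono v) simp
    \<comment> \<open>Boundedness of \<open>L\<close> gives an estimate quadratic in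
      \<open>?S\<close> on the left and linear on the right; dividing by \<open>?S\<close> makes it
      uniform in \<open>n\<close>.\<close>
    finally have "?S * ?S \<le> (C\<^sup>2 * K) * ?S" by (simp add: power2_eq_square mult.assoc)
    moreover have "0 \<le> ?S" by (simp add: sum_nonneg)
    moreover have "0 \<le> C\<^sup>2 * K"
      using K[of 1] by (meson order_trans zero_le_mult_iff zero_le_power2 zero_less_one)
    ultimately show ?thesis
      by (cases "?S = 0") (auto simp: mult_le_cancel_right)
  qed
  have "summable (\<lambda>k. (L (e k))\<^sup>2)"
    using bound by (intro summableI_nonneg_bounded[where x = "C\<^sup>2 * K"]) auto
  then have "(\<lambda>k. sqrt ((L (e k))\<^sup>2)) \<longlonglongrightarrow> sqrt 0"
    by (intro tendsto_real_sqrt summable_LIMSEQ_zero)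
  then show ?thesis
    by (simp add: e_def tendsto_rabs_zero_iff)
qed

text \<open>At the radius where \<open>\<eta>\<close> has argument 3/2, the centre of its support,
  \<open>ln (1 / r)\<close> is at most \<open>2 * \<delta>\<close>. The denominator is then at most
  \<open>sqrt \<delta>\<close>, the scale of the bump's height.\<close>

lemma bump_ratio:
  assumes "0 < \<delta>" "\<delta> \<le> 1/4"
  obtains r where "0 < r" "r < 1"
    "\<eta> (3/2) \<le> radial_profile (bump \<delta>) r / sqrt (1 / (2 * pi) * ln (1 / r))"
proof
  define r where "r = sqrt (1 - 3/2 * \<delta>)"
  show r: "0 < sqrt (1 - 3/2 * \<delta>)" "sqrt (1 - 3/2 * \<delta>) < 1" using assms by auto
  have r': "0 < r" "r < 1" using r unfolding r_def by blast+
  have r2: "r\<^sup>2 = 1 - 3/2 * \<delta>" using assms by (simp add: r_def)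
  have z: "inverse \<delta> * (1 - r\<^sup>2) = 3/2" using assms by (simp add: r2 field_simps)
  have "(norm (r *\<^sub>R axis 1 1 :: real^2))\<^sup>2 = r\<^sup>2" by (simp add: norm_axis_1)
  then have p: "radial_profile (bump \<delta>) r = sqrt \<delta> * \<eta> (3/2)"
    unfolding radial_profile_def bump_def by (simp only: z)
  have "2 * ln (1 / r) = ln (1 / r\<^sup>2)"
    using r' by (simp add: ln_div ln_realpow)
  also have "\<dots> \<le> 1 / r\<^sup>2 - 1"
    using r' by (intro ln_le_minus_one) simp
  \<comment> \<open>Since \<open>\<delta>\<close> is at most 1/4, \<open>r\<^sup>2\<close> is at
    least 5/8, which bounds \<open>(3/2 * \<delta>) / r\<^sup>2\<close>.\<close>
  also have "\<dots> \<le> 4 * \<delta>"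
    using assms mult_left_mono[of \<delta> "1/4" \<delta>] by (simp add: r2 field_simps)
  finally have l: "ln (1 / r) \<le> 2 * \<delta>" by simp
  have "ln (1 / r) > 0" using r' by (intro ln_gt_zero) simp_all
  then have pos: "sqrt (1 / (2 * pi) * ln (1 / r)) > 0" by simp
  have "1 / (2 * pi) * ln (1 / r) \<le> 1 / 2 * (2 * \<delta>)"
    using l \<open>ln (1 / r) > 0\<close> pi_gt3 by (intro mult_mono) (auto simp: field_simps)
  then have "sqrt (1 / (2 * pi) * ln (1 / r)) \<le> sqrt \<delta>" by simp
  then have "\<eta> (3/2) * sqrt (1 / (2 * pi) * ln (1 / r)) \<le> sqrt \<delta> * \<eta> (3/2)"
    using flat_0_bounds by (subst mult.commute, intro mult_right_mono) (auto simp: \<eta>_def)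
  then show "\<eta> (3/2) \<le> radial_profile (bump \<delta>) (sqrt (1 - 3/2 * \<delta>)) /
      sqrt (1 / (2 * pi) * ln (1 / sqrt (1 - 3/2 * \<delta>)))"
    using pos unfolding r_def[symmetric] p by (simp add: pos_le_divide_eq)
qed

theorem proposition2:
  fixes u :: "real^2 \<Rightarrow> real"
  assumes "u \<in> H10_rad"
  shows "\<exists>U :: nat \<Rightarrow> real^2 \<Rightarrow> real.
           (\<forall>k. U k \<in> H10_rad) \<and> H10_rad_weakly_tendsto U u \<and>
           \<not> ((\<lambda>k. norm_2star (U k)) \<longlonglongrightarrow> norm_2star u)"
proof -
  define B where "B = 2 * H10_norm u"
  define q where "q = \<eta> (3/2)"
  have q: "q > 0" by (simp add: q_def \<eta>_def flat_def)
  \<comment> \<open>At the radius given by \<open>bump_ratio\<close> the term \<open>t * e k\<close>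
    contributes at least \<open>2 * B + 1\<close> and \<open>u\<close> takes away at most
    \<open>B\<close>, leaving \<open>B + 1\<close>.\<close>
  define t where "t = (2 * B + 1) / q"
  have "B \<ge> 0" by (simp add: B_def H10_norm_def L2_norm_nonneg)
  then have t: "t \<ge> 0" "t * q = 2 * B + 1" using q by (auto simp: t_def)
  define e where "e k = bump ((1/2) ^ (k + 2))" for k :: nat
  define U where "U k x = u x + t * e k x" for k x
  have e: "radial_test (e k)" for k
    unfolding e_def by (intro bump_radial_test) simp
  have "norm_2star u \<le> ereal B"
    unfolding norm_2star_def B_def
    using H10_rad_profile_bound[OF assms] by (intro SUP_least) simp
  moreover have "ereal (B + 1) \<le> norm_2star (U k)" for k
  proof -
    have "(1/2 :: real) ^ (k + 2) \<le> (1/2) ^ 2" by (intro power_decreasing) auto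
    then have "(1/2 :: real) ^ (k + 2) \<le> 1/4" by (simp add: power2_eq_square)
    then obtain r where r: "0 < r" "r < 1"
      and ratio: "q \<le> radial_profile (e k) r / sqrt (1 / (2 * pi) * ln (1 / r))"
      using bump_ratio[of "(1/2) ^ (k + 2)"] unfolding e_def q_def by auto
    let ?s = "sqrt (1 / (2 * pi) * ln (1 / r))"
    have "ln (1 / r) > 0" using r by (intro ln_gt_zero) simp_all
    then have s: "?s > 0" by simp
    have "2 * B + 1 \<le> t * (radial_profile (e k) r / ?s)"
      using mult_left_mono[OF ratio t(1)] t(2) by simp
    moreover have "\<bar>radial_profile u r\<bar> / ?s \<le> B"
      unfolding B_def by (rule H10_rad_profile_bound[OF assms r])
    ultimately have "B + 1 \<le> (t * radial_profile (e k) r - \<bar>radial_profile u r\<bar>) / ?s"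
      by (simp add: diff_divide_distrib)
    also have "\<dots> \<le> \<bar>radial_profile (U k) r\<bar> / ?s"
      using s by (intro divide_right_mono) (auto simp: U_def radial_profile_def)
    finally have "ereal (B + 1) \<le> ereal (\<bar>radial_profile (U k) r\<bar> / ?s)" by simp
    also have "\<dots> \<le> norm_2star (U k)"
      unfolding norm_2star_def using r by (intro SUP_upper) simp
    finally show ?thesis .
  qed
  \<comment> \<open>A limit of the values would be at least \<open>B + 1\<close>, whereas
    \<open>norm_2star u\<close> is at most \<open>B\<close>.\<close>
  ultimately have "\<not> ((\<lambda>k. norm_2star (U k)) \<longlonglongrightarrow> norm_2star u)"
    using LIMSEQ_le_const[of "\<lambda>k. norm_2star (U k)" "norm_2star u" "ereal (B + 1)"]
      order_trans[of "ereal (B + 1)" "norm_2star u" "ereal B"] by auto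
  moreover have "H10_rad_weakly_tendsto U u"
    unfolding H10_rad_weakly_tendsto_def
  proof (intro allI impI)
    fix L assume L: "H10_rad_functional L"
    have "L (U k) = L u + t * L (e k)" for k
    proof -
      have "(\<lambda>x. t * e k x) \<in> H10_rad"
        using radial_test_add_scaled[OF radial_test_zero e] by (simp add: radial_test_H10_rad)
      from H10_rad_functionalD(1)[OF L assms this]
      have "L (U k) = L u + L (\<lambda>x. t * e k x)"
        by (simp add: U_def[abs_def])
      then show ?thesis
        by (simp add: H10_rad_functionalD(2)[OF L radial_test_H10_rad[OF e]])
    qed
    moreover have "(\<lambda>k. L u + t * L (e k)) \<longlonglongrightarrow> L u + t * 0"
      unfolding e_def by (intro tendsto_intros functional_bump_tendsto_zero L)
    ultimately show "(\<lambda>k. L (U k)) \<longlonglongrightarrow> L u" by simp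
  qed
  moreover have "U k \<in> H10_rad" for k
    unfolding U_def by (rule H10_rad_add_test[OF assms e])
  ultimately show ?thesis by blast
qed

end
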